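(* Let $\mathcal{A}$ be a hyperplane arrangement in $\mathbb{R}^n$. Then \[\chi_{\mathcal{A}}(t)=(-1)^n\sum_{R\text{ a region of }\mathcal{A}}\frac{\chi_{\underline{\mathcal{A}}^{V_R}}(t)}{\chi_{\underline{\mathcal{A}}^{V_R}}(-1)}.\]
   Context: A hyperplane arrangement is a finite set of affine hyperplanes $H_i=\{x:w_i\cdot x=a_i\}$; a region is a connected component of the complement of their union. $\operatorname{Rec}(R)=\{v:R+v\subseteq R\}$ and $V_R=\operatorname{span}(\operatorname{Rec}(R))$. Centralization: $\underline{H_i}=\{x:w_i\cdot x=0\}$, $\underline{\mathcal{A}}=\{\underline{H_i}\}$. Restriction: $\mathcal{B}^V=\{H\cap V:H\in\mathcal{B}\}\setminus\{\emptyset,V\}$, an arrangement in the space $V$. For an arrangement $\mathcal{B}$ in an ambient space $E$, $\mathcal{L}(\mathcal{B})$ is the set of nonempty intersections of subsets of its hyperplanes (with $E$ as the empty intersection), ordered by reverse inclusion, and $\chi_{\mathcal{B}}(t)=\sum_{F\in\mathcal{L}(\mathcal{B})}\mu(E,F)\,t^{\dim F}$, $\mu$ the Möbius function. *)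

theory Defs
  imports "HOL-Analysis.Analysis" "HOL-Computational_Algebra.Polynomial"
begin

definition hyperplane_arrangement :: "'a::euclidean_space set set \<Rightarrow> bool" where
  "hyperplane_arrangement A \<longleftrightarrow>
     finite A \<and> (\<forall>H\<in>A. \<exists>w a. w \<noteq> 0 \<and> H = {x. w \<bullet> x = a})"

definition regions :: "'a::euclidean_space set set \<Rightarrow> 'a set set" where
  "regions A = components (UNIV - \<Union>A)"

definition Rec :: "'a::euclidean_space set \<Rightarrow> 'a set" where
  "Rec R = {v. (\<lambda>x. x + v) ` R \<subseteq> R}"

definition rec_space :: "'a::euclidean_space set \<Rightarrow> 'a set" where
  "rec_space R = span (Rec R)"

(* The normal w of a given hyperplane is unique up to a nonzero scalar, so each
   hyperplane of A contributes exactly one linear hyperplane. *)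
definition centralization :: "'a::euclidean_space set set \<Rightarrow> 'a set set" where
  "centralization A = {{x. w \<bullet> x = 0} | w a. w \<noteq> 0 \<and> {x. w \<bullet> x = a} \<in> A}"

definition restriction :: "'a set set \<Rightarrow> 'a set \<Rightarrow> 'a set set" where
  "restriction B V = (\<lambda>H. H \<inter> V) ` B - {{}, V}"

(* E is the ambient space of B, made explicit because restrictions live in a
   proper subspace in general; the choice S = {} gives F = E. *)
definition flats :: "'a set \<Rightarrow> 'a set set \<Rightarrow> 'a set set" where
  "flats E B = {F. F \<noteq> {} \<and> (\<exists>S\<subseteq>B. F = E \<inter> \<Inter>S)}"

(* Moebius function of the poset P ordered by reverse inclusion (X below Y iff
   Y is a subset of X), by the usual recursion over the half-open interval
   [X, Y). The value 0 for infinite P only serves to make the function total. *)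
function moebius :: "'a set set \<Rightarrow> 'a set \<Rightarrow> 'a set \<Rightarrow> int" where
  "moebius P X Y =
     (if \<not> finite P then 0
      else if X = Y then 1
      else if Y \<subset> X then - (\<Sum>Z\<in>{Z\<in>P. Y \<subset> Z \<and> Z \<subseteq> X}. moebius P X Z)
      else 0)"
  by pat_completeness auto
termination
proof (relation "Wellfounded.measure (\<lambda>(P, X, Y). card {Z\<in>P. Y \<subset> Z})")
  fix P :: "'a set set" and X Y Z
  assume "\<not> infinite P" and Z: "Z \<in> {Z \<in> P. Y \<subset> Z \<and> Z \<subseteq> X}"
  then have "finite {W \<in> P. Y \<subset> W}" by simp
  moreover have "{W \<in> P. Z \<subset> W} \<subset> {W \<in> P. Y \<subset> W}" using Z by blast
  ultimately show "((P, X, Z), (P, X, Y)) \<in> Wellfounded.measure (\<lambda>(P, X, Y). card {Z\<in>P. Y \<subset> Z})"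
    by (simp add: psubset_card_mono)
qed simp

declare moebius.simps [simp del]

definition charpoly :: "'a::euclidean_space set \<Rightarrow> 'a set set \<Rightarrow> real poly" where
  "charpoly E B =
     (\<Sum>F\<in>flats E B. monom (of_int (moebius (flats E B) E F)) (nat (aff_dim F)))"

end

theory Submission
  imports Defs
begin

text \<open>
  Expanding every characteristic polynomial as a Whitney sum over subsets of hyperplanes and
  applying Moebius inversion in the intersection lattice of the centralization gives
  \<open>\<chi>\<^sub>A(t) = (\<Sum>X. b(X) \<chi>\<^sub>X(t))\<close>, where \<open>X\<close> ranges over the linear flats, \<open>\<chi>\<^sub>X\<close> belongs to the
  restriction of the centralization to \<open>X\<close>, and \<open>b(X)\<close> is the value at 1 of the characteristic
  polynomial of the hyperplanes parallel to \<open>X\<close>.  It remains to see that \<open>b(X) \<chi>\<^sub>X(-1)\<close> is,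
  up to the sign \<open>(-1)\<^sup>n\<close>, the number of regions \<open>R\<close> with \<open>V\<^sub>R = X\<close>.  The relative interior of \<open>Rec R\<close> is a
  face of the centralization, with span \<open>V\<^sub>R\<close>.  For a face \<open>\<sigma>\<close> with span \<open>X\<close>, the regions whose recession
  cone contains \<open>\<sigma>\<close> correspond to the regions of the subarrangement parallel to \<open>X\<close>, and the
  faces above \<open>\<sigma>\<close> with span \<open>Y\<close> to the regions of a restriction to \<open>Y\<close>.  Both are counted by
  Zaslavsky's theorem, so the expansion above, applied at \<open>t = -1\<close> to the subarrangement,
  determines by induction the number of regions belonging to each face.
\<close>

subsection \<open>Whitney sums\<close>

text \<open>With \<open>\<phi> F\<close> the monomial of degree dim F this is Whitney's formula for
  the characteristic polynomial. The family is indexed because distinct parallel hyperplanes share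
  one linear hyperplane; a general \<open>\<phi>\<close> covers the polynomial, its value at -1 and
  the coefficients b(X) at once.\<close>

definition whitney :: "('a set \<Rightarrow> 'r::comm_ring_1) \<Rightarrow> 'a set \<Rightarrow> 'i set \<Rightarrow> ('i \<Rightarrow> 'a set) \<Rightarrow> 'r" where
  "whitney \<phi> E I h = (\<Sum>S\<in>Pow I. (-1) ^ card S * \<phi> (E \<inter> \<Inter>(h ` S)))"

text \<open>Unlike \<open>flats\<close>, this poset may contain the empty set, so that passing from
  \<open>Y\<close> to \<open>Y \<inter> h k\<close> needs no case distinction.\<close>

definition intersections :: "'a set \<Rightarrow> 'i set \<Rightarrow> ('i \<Rightarrow> 'a set) \<Rightarrow> 'a set set" where
  "intersections E I h = (\<lambda>S. E \<inter> \<Inter>(h ` S)) ` Pow I"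

lemma finite_intersections: "finite I \<Longrightarrow> finite (intersections E I h)"
  by (simp add: intersections_def)

lemma intersections_subset: "X \<in> intersections E I h \<Longrightarrow> X \<subseteq> E"
  by (auto simp: intersections_def)

lemma intersections_canonical:
  assumes "X \<in> intersections E I h"
  shows "E \<inter> \<Inter>(h ` {i\<in>I. X \<subseteq> h i}) = X"
  using assms unfolding intersections_def by blast

lemma intersections_below:
  assumes "Y \<in> intersections E I h"
  shows "intersections Y I h = {X \<in> intersections E I h. X \<subseteq> Y}"
proof (intro subset_antisym subsetI)
  fix X assume "X \<in> intersections Y I h"
  then obtain S where S: "S \<subseteq> I" "X = Y \<inter> \<Inter>(h ` S)" by (auto simp: intersections_def)
  obtain T where T: "T \<subseteq> I" "Y = E \<inter> \<Inter>(h ` T)" using assms by (auto simp: intersections_def)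
  have "X = E \<inter> \<Inter>(h ` (S \<union> T))" using S T by auto
  then show "X \<in> {X \<in> intersections E I h. X \<subseteq> Y}"
    using S T unfolding intersections_def by blast
next
  fix X assume X: "X \<in> {X \<in> intersections E I h. X \<subseteq> Y}"
  then obtain S where S: "S \<subseteq> I" "X = E \<inter> \<Inter>(h ` S)" by (auto simp: intersections_def)
  have "X = Y \<inter> \<Inter>(h ` S)" using X S intersections_subset[OF assms] by blast
  then show "X \<in> intersections Y I h" using S by (auto simp: intersections_def)
qed

lemma whitney_empty [simp]: "whitney \<phi> E {} h = \<phi> E"
  by (simp add: whitney_def)

text \<open>Deletion and restriction: subsets containing \<open>i\<close> are subsets of
  \<open>I\<close> with \<open>i\<close> added, which flips the sign and replaces \<open>E\<close>
  by \<open>E \<inter> h i\<close>.\<close>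

lemma whitney_insert:
  assumes "finite I" "i \<notin> I"
  shows "whitney \<phi> E (insert i I) h = whitney \<phi> E I h - whitney \<phi> (E \<inter> h i) I h"
proof -
  have inj: "inj_on (insert i) (Pow I)" using assms(2) by (auto simp: inj_on_def)
  have "whitney \<phi> E (insert i I) h = whitney \<phi> E I h +
      (\<Sum>S\<in>insert i ` Pow I. (-1) ^ card S * \<phi> (E \<inter> \<Inter>(h ` S)))"
    unfolding whitney_def Pow_insert
    by (rule sum.union_disjoint) (use assms in auto)
  also have "(\<Sum>S\<in>insert i ` Pow I. (-1) ^ card S * \<phi> (E \<inter> \<Inter>(h ` S)))
      = (\<Sum>S\<in>Pow I. - ((-1) ^ card S * \<phi> (E \<inter> h i \<inter> \<Inter>(h ` S))))"
  proof (subst sum.reindex[OF inj], rule sum.cong, simp)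
    fix S assume "S \<in> Pow I"
    then have "finite S" "i \<notin> S" using assms finite_subset by auto
    then show "((\<lambda>S. (-1) ^ card S * \<phi> (E \<inter> \<Inter>(h ` S))) \<circ> insert i) S =
        - ((-1) ^ card S * \<phi> (E \<inter> h i \<inter> \<Inter>(h ` S)))"
      by (simp add: Int_assoc)
  qed
  finally show ?thesis by (simp add: whitney_def sum_negf)
qed

text \<open>Since \<open>E \<inter> h i = E\<close>, the deletion and restriction terms
  cancel.\<close>

lemma whitney_eq_0:
  assumes "finite I" "i \<in> I" "E \<subseteq> h i"
  shows "whitney \<phi> E I h = 0"
proof -
  have "E \<inter> h i = E" using assms(3) by auto
  then show ?thesis
    using whitney_insert[of "I - {i}" i \<phi> E h] assms(1,2) by (simp add: insert_absorb)
qed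

lemma whitney_empty_space:
  assumes "\<phi> {} = 0"
  shows "whitney \<phi> {} I h = 0"
  using assms by (simp add: whitney_def)

text \<open>This is the Moebius inversion of the expansion of a Whitney sum over flats. Duplicate
  and empty sets \<open>h i\<close> are harmless, which is what makes the induction on \<open>I\<close> work.\<close>

lemma sum_whitney_intersections:
  assumes "finite I"
  shows "(\<Sum>X\<in>intersections Y I h. whitney \<phi> X {i\<in>I. \<not> X \<subseteq> h i} h) = \<phi> Y"
  using assms
proof (induction I arbitrary: Y rule: finite_induct)
  case empty
  then show ?case by (simp add: intersections_def)
next
  case (insert k I)
  let ?J = "\<lambda>X. {i\<in>I. \<not> X \<subseteq> h i}"
  let ?F = "\<lambda>X. whitney \<phi> X {i\<in>insert k I. \<not> X \<subseteq> h i} h"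
  let ?L = "intersections Y I h" and ?M = "intersections (Y \<inter> h k) I h"
  have fin: "finite ?L" "finite ?M" using insert.hyps by (auto intro: finite_intersections)
  \<comment> \<open>Flats of the enlarged family are sorted by whether they lie in
    \<open>h k\<close>; those that do are exactly the flats of
    \<open>Y \<inter> h k\<close>.\<close>
  have LM: "intersections Y (insert k I) h = {X\<in>?L. \<not> X \<subseteq> h k} \<union> ?M"
  proof -
    have "intersections Y (insert k I) h = ?L \<union> ?M"
      by (simp add: intersections_def Pow_insert image_Un image_image Int_assoc)
    moreover have "X \<in> ?M" if X: "X \<in> ?L" "X \<subseteq> h k" for X
    proof -
      obtain S where "S \<subseteq> I" "X = Y \<inter> \<Inter>(h ` S)" using X by (auto simp: intersections_def)
      then have "X = (Y \<inter> h k) \<inter> \<Inter>(h ` S)" using X by auto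
      then show ?thesis using \<open>S \<subseteq> I\<close> by (auto simp: intersections_def)
    qed
    ultimately show ?thesis by blast
  qed
  have Mk: "X \<subseteq> h k" if "X \<in> ?M" for X using intersections_subset[OF that] by auto
  have "(\<Sum>X\<in>intersections Y (insert k I) h. ?F X) = (\<Sum>X\<in>{X\<in>?L. \<not> X \<subseteq> h k}. ?F X) + (\<Sum>X\<in>?M. ?F X)"
    unfolding LM by (rule sum.union_disjoint) (use fin Mk in auto)
  also have "(\<Sum>X\<in>?M. ?F X) = (\<Sum>X\<in>?M. whitney \<phi> X (?J X) h)"
  proof (rule sum.cong)
    fix X assume "X \<in> ?M"
    then have "{i\<in>insert k I. \<not> X \<subseteq> h i} = ?J X" using Mk by auto
    then show "?F X = whitney \<phi> X (?J X) h" by simp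
  qed simp
  also have "\<dots> = \<phi> (Y \<inter> h k)" by (rule insert.IH)
  also have "(\<Sum>X\<in>{X\<in>?L. \<not> X \<subseteq> h k}. ?F X)
      = (\<Sum>X\<in>{X\<in>?L. \<not> X \<subseteq> h k}. whitney \<phi> X (?J X) h - whitney \<phi> (X \<inter> h k) (?J X) h)"
  proof (rule sum.cong)
    fix X assume "X \<in> {X\<in>?L. \<not> X \<subseteq> h k}"
    then have "{i\<in>insert k I. \<not> X \<subseteq> h i} = insert k (?J X)" by auto
    then show "?F X = whitney \<phi> X (?J X) h - whitney \<phi> (X \<inter> h k) (?J X) h"
      using insert.hyps by (simp add: whitney_insert)
  qed simp
  \<comment> \<open>For flats inside \<open>h k\<close> the two terms coincide, so the sum may run
    over all of \<open>?L\<close>.\<close>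
  also have "\<dots> = (\<Sum>X\<in>?L. whitney \<phi> X (?J X) h - whitney \<phi> (X \<inter> h k) (?J X) h)"
    by (rule sum.mono_neutral_left) (use fin in \<open>auto simp: Int_absorb2\<close>)
  also have "\<dots> = \<phi> Y - (\<Sum>X\<in>?L. whitney \<phi> (X \<inter> h k) (?J X) h)"
    by (simp add: sum_subtractf insert.IH)
  also have "(\<Sum>X\<in>?L. whitney \<phi> (X \<inter> h k) (?J X) h) = \<phi> (Y \<inter> h k)"
  proof -
    \<comment> \<open>\<open>c Z\<close> is the smallest flat of the smaller family that contains
      \<open>Z\<close>; cutting it with \<open>h k\<close> returns \<open>Z\<close>. A flat
      \<open>X\<close> outside the image of \<open>c\<close> contributes zero, because some
      \<open>h i\<close> contains \<open>X \<inter> h k\<close> without containing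
      \<open>X\<close>.\<close>
    define c where "c Z = Y \<inter> \<Inter>(h ` {i\<in>I. Z \<subseteq> h i})" for Z
    have Zc: "c Z \<inter> h k = Z" if "Z \<in> ?M" for Z
      using intersections_canonical[OF that] unfolding c_def by auto
    have Jc: "?J (c Z) = ?J Z" if "Z \<in> ?M" for Z
    proof -
      have "Z \<subseteq> c Z" using Zc[OF that] by blast
      moreover have "c Z \<subseteq> h i" if "i \<in> I" "Z \<subseteq> h i" for i using that unfolding c_def by blast
      ultimately show ?thesis by blast
    qed
    have inj: "inj_on c ?M" by (rule inj_on_inverseI[where g = "\<lambda>X. X \<inter> h k"]) (rule Zc)
    have cL: "c ` ?M \<subseteq> ?L" unfolding c_def intersections_def by auto
    have "(\<Sum>X\<in>?L. whitney \<phi> (X \<inter> h k) (?J X) h) = (\<Sum>X\<in>c ` ?M. whitney \<phi> (X \<inter> h k) (?J X) h)"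
    proof (rule sum.mono_neutral_right[OF fin(1) cL], rule ballI)
      fix X assume X: "X \<in> ?L - c ` ?M"
      show "whitney \<phi> (X \<inter> h k) (?J X) h = 0"
      proof (cases "\<exists>i\<in>?J X. X \<inter> h k \<subseteq> h i")
        case True
        then show ?thesis using insert.hyps(1) by (auto intro: whitney_eq_0)
      next
        case False
        then have "{i\<in>I. X \<inter> h k \<subseteq> h i} = {i\<in>I. X \<subseteq> h i}" by blast
        then have "c (X \<inter> h k) = X"
          unfolding c_def using intersections_canonical[of X Y I h] X by simp
        moreover have "X \<inter> h k \<in> ?M"
        proof -
          obtain S where "S \<subseteq> I" "X = Y \<inter> \<Inter>(h ` S)" using X by (auto simp: intersections_def)
          then have "X \<inter> h k = (Y \<inter> h k) \<inter> \<Inter>(h ` S)" by auto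
          then show ?thesis using \<open>S \<subseteq> I\<close> by (auto simp: intersections_def)
        qed
        ultimately show ?thesis using X by (metis DiffD2 imageI)
      qed
    qed
    also have "\<dots> = (\<Sum>Z\<in>?M. whitney \<phi> Z (?J Z) h)"
      by (subst sum.reindex[OF inj]) (auto intro!: sum.cong simp: Zc Jc)
    also have "\<dots> = \<phi> (Y \<inter> h k)" by (rule insert.IH)
    finally show ?thesis .
  qed
  finally show ?case by simp
qed

text \<open>In the applications \<open>l\<close> is the centralization of \<open>h\<close>. The
  value of \<open>\<phi>\<close> on each linear intersection is expanded by
  \<open>sum_whitney_intersections\<close>. After exchanging the sums, a flat \<open>X\<close> meets
  exactly the subsets of the indices with \<open>X \<subseteq> l i\<close>; their signs, counted
  when the intersection of the \<open>h i\<close> is nonempty, form its coefficient.\<close>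

lemma whitney_expansion:
  fixes \<phi> :: "'a set \<Rightarrow> 'r::comm_ring_1" and h l :: "'i \<Rightarrow> 'a set"
  assumes I: "finite I" and empty: "\<phi> {} = 0"
    and eq: "\<And>S. S \<subseteq> I \<Longrightarrow> \<Inter>(h ` S) \<noteq> {} \<Longrightarrow> \<phi> (\<Inter>(h ` S)) = \<phi> (\<Inter>(l ` S))"
  shows "whitney \<phi> UNIV I h = (\<Sum>X\<in>intersections UNIV I l.
    of_int (whitney (\<lambda>F. if F = {} then 0 else 1) UNIV {i\<in>I. X \<subseteq> l i} h) *
    whitney \<phi> X {i\<in>I. \<not> X \<subseteq> l i} l)"
proof -
  let ?L = "intersections UNIV I l"
  let ?W = "\<lambda>X. whitney \<phi> X {i\<in>I. \<not> X \<subseteq> l i} l"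
  let ?c = "\<lambda>S. (-1) ^ card S * (if \<Inter>(h ` S) = {} then 0 else 1) :: 'r"
  have "whitney \<phi> UNIV I h = (\<Sum>S\<in>Pow I. ?c S * \<phi> (\<Inter>(l ` S)))"
    unfolding whitney_def by (rule sum.cong) (use empty eq in auto)
  also have "\<dots> = (\<Sum>S\<in>Pow I. \<Sum>X\<in>?L. if X \<subseteq> \<Inter>(l ` S) then ?c S * ?W X else 0)"
  proof (rule sum.cong)
    fix S assume "S \<in> Pow I"
    then have "\<Inter>(l ` S) \<in> ?L" by (auto simp: intersections_def)
    from intersections_below[OF this] have "\<phi> (\<Inter>(l ` S)) = (\<Sum>X\<in>{X\<in>?L. X \<subseteq> \<Inter>(l ` S)}. ?W X)"
      using sum_whitney_intersections[OF I, where Y = "\<Inter>(l ` S)" and h = l and \<phi> = \<phi>] by simp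
    also have "\<dots> = (\<Sum>X\<in>?L. if X \<subseteq> \<Inter>(l ` S) then ?W X else 0)"
      using I by (intro sum.inter_filter finite_intersections)
    finally show "?c S * \<phi> (\<Inter>(l ` S)) = (\<Sum>X\<in>?L. if X \<subseteq> \<Inter>(l ` S) then ?c S * ?W X else 0)"
      by (simp only: sum_distrib_left if_distrib[of "\<lambda>x. _ * x"] mult_zero_right)
  qed simp
  also have "\<dots> = (\<Sum>X\<in>?L. \<Sum>S\<in>Pow I. if X \<subseteq> \<Inter>(l ` S) then ?c S * ?W X else 0)"
    by (rule sum.swap)
  also have "\<dots> = (\<Sum>X\<in>?L. of_int (whitney (\<lambda>F. if F = {} then 0 else 1) UNIV {i\<in>I. X \<subseteq> l i} h) * ?W X)"
  proof (rule sum.cong)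
    fix X assume "X \<in> ?L"
    have "{S \<in> Pow I. X \<subseteq> \<Inter>(l ` S)} = Pow {i\<in>I. X \<subseteq> l i}" by auto
    then have "(\<Sum>S\<in>Pow I. if X \<subseteq> \<Inter>(l ` S) then ?c S * ?W X else 0)
       = (\<Sum>S\<in>Pow {i\<in>I. X \<subseteq> l i}. ?c S * ?W X)"
      using I by (simp only: sum.inter_filter[symmetric] finite_Pow_iff)
    also have "\<dots> = (\<Sum>S\<in>Pow {i\<in>I. X \<subseteq> l i}. ?c S) * ?W X"
      by (simp add: sum_distrib_right)
    also have "(\<Sum>S\<in>Pow {i\<in>I. X \<subseteq> l i}. ?c S) =
       of_int (whitney (\<lambda>F. if F = {} then 0 else 1) UNIV {i\<in>I. X \<subseteq> l i} h)"
      unfolding whitney_def of_int_sum by (rule sum.cong) auto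
    finally show "(\<Sum>S\<in>Pow I. if X \<subseteq> \<Inter>(l ` S) then ?c S * ?W X else 0) =
      of_int (whitney (\<lambda>F. if F = {} then 0 else 1) UNIV {i\<in>I. X \<subseteq> l i} h) * ?W X" .
  qed simp
  finally show ?thesis .
qed

subsection \<open>The characteristic polynomial as a Whitney sum\<close>

text \<open>The empty set gets the value 0 explicitly, since \<open>nat\<close> would turn its
  dimension -1 into 0.\<close>

definition flat_monom :: "'a::euclidean_space set \<Rightarrow> real poly" where
  "flat_monom F = (if F = {} then 0 else monom 1 (nat (aff_dim F)))"

lemma sum_minus_one_power_card_Pow:
  assumes "finite I" "I \<noteq> {}"
  shows "(\<Sum>S\<in>Pow I. (-1) ^ card S :: int) = 0"
proof -
  obtain i where "i \<in> I" using assms by auto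
  then have "whitney (\<lambda>_. 1::int) UNIV I (\<lambda>_. UNIV :: unit set) = 0"
    using assms by (intro whitney_eq_0) auto
  then show ?thesis by (simp add: whitney_def)
qed

text \<open>Both sides satisfy the same recursion: summing the right-hand side over the flats
  between \<open>F\<close> and \<open>E\<close> gives the alternating sum over all subsets of the
  hyperplanes through \<open>F\<close>, which vanishes for \<open>F \<noteq> E\<close>. By
  \<open>proper\<close>, only the empty subset cuts out \<open>E\<close>.\<close>

lemma moebius_eq_sum:
  fixes h :: "'i \<Rightarrow> 'a set"
  assumes I: "finite I" and proper: "\<And>i. i \<in> I \<Longrightarrow> \<not> E \<subseteq> h i"
    and F: "F \<in> intersections E I h - {{}}"
  shows "moebius (intersections E I h - {{}}) E F =
    (\<Sum>S\<in>{S\<in>Pow I. E \<inter> \<Inter>(h ` S) = F}. (-1) ^ card S)"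
  using F
proof (induction "card {Z \<in> intersections E I h. F \<subset> Z}" arbitrary: F rule: less_induct)
  case less
  let ?P = "intersections E I h - {{}}"
  let ?c = "\<lambda>F. \<Sum>S\<in>{S\<in>Pow I. E \<inter> \<Inter>(h ` S) = F}. (-1) ^ card S :: int"
  have fin: "finite ?P" "finite (intersections E I h)" using finite_intersections[OF I] by auto
  have FE: "F \<subseteq> E" using less.prems intersections_subset[of F E I h] by blast
  show ?case
  proof (cases "E = F")
    case True
    have "{S\<in>Pow I. E \<inter> \<Inter>(h ` S) = F} = {{}}" using proper True by auto
    then show ?thesis using fin(1) by (subst moebius.simps) (simp add: True)
  next
    case False
    let ?U = "{Z\<in>?P. F \<subset> Z \<and> Z \<subseteq> E}"
    let ?I = "{i\<in>I. F \<subseteq> h i}"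
    have IH: "moebius ?P E Z = ?c Z" if "Z \<in> ?U" for Z
    proof (rule less.hyps)
      have "{W \<in> intersections E I h. Z \<subset> W} \<subset> {W \<in> intersections E I h. F \<subset> W}"
        using that by auto
      then show "card {W \<in> intersections E I h. Z \<subset> W} < card {W \<in> intersections E I h. F \<subset> W}"
        using fin by (intro psubset_card_mono) auto
    qed (use that in auto)
    have "?I \<noteq> {}"
    proof
      assume "?I = {}"
      then have "E = F" using intersections_canonical[of F E I h] less.prems by auto
      then show False using False by simp
    qed
    then have "0 = (\<Sum>S\<in>Pow ?I. (-1) ^ card S :: int)"
      using I by (simp add: sum_minus_one_power_card_Pow)
    also have "\<dots> = (\<Sum>Z\<in>insert F ?U. \<Sum>S\<in>{S\<in>Pow ?I. E \<inter> \<Inter>(h ` S) = Z}. (-1) ^ card S)"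
    proof (rule sum.group[symmetric])
      show "(\<lambda>S. E \<inter> \<Inter>(h ` S)) ` Pow ?I \<subseteq> insert F ?U"
      proof (rule image_subsetI)
        fix S assume S: "S \<in> Pow ?I"
        then have "F \<subseteq> E \<inter> \<Inter>(h ` S)" using FE by auto
        moreover have "E \<inter> \<Inter>(h ` S) \<in> intersections E I h"
          using S by (auto simp: intersections_def)
        ultimately show "E \<inter> \<Inter>(h ` S) \<in> insert F ?U" using less.prems by auto
      qed
    qed (use I fin in auto)
    also have "\<dots> = (\<Sum>Z\<in>insert F ?U. ?c Z)"
    proof (rule sum.cong)
      fix Z assume "Z \<in> insert F ?U"
      then have "{S\<in>Pow ?I. E \<inter> \<Inter>(h ` S) = Z} = {S\<in>Pow I. E \<inter> \<Inter>(h ` S) = Z}" by auto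
      then show "(\<Sum>S\<in>{S\<in>Pow ?I. E \<inter> \<Inter>(h ` S) = Z}. (-1) ^ card S) = ?c Z" by simp
    qed simp
    also have "\<dots> = ?c F + (\<Sum>Z\<in>?U. ?c Z)" using fin by (subst sum.insert) auto
    also have "(\<Sum>Z\<in>?U. ?c Z) = (\<Sum>Z\<in>?U. moebius ?P E Z)" using IH by (intro sum.cong) auto
    finally show ?thesis using fin False FE by (simp add: moebius.simps[of ?P E F] moebius.simps[of ?P F F])
  qed
qed

text \<open>Whitney's theorem, by grouping subsets according to their flats. Only the flats of
  \<open>B\<close> and of the family \<open>h\<close> have to agree, so several indices may give the
  same hyperplane.\<close>

lemma charpoly_eq_whitney:
  fixes h :: "'i \<Rightarrow> 'a::euclidean_space set"
  assumes I: "finite I" and proper: "\<And>i. i \<in> I \<Longrightarrow> \<not> E \<subseteq> h i"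
    and flats: "flats E B = intersections E I h - {{}}"
  shows "charpoly E B = whitney flat_monom E I h"
proof -
  let ?P = "intersections E I h - {{}}"
  let ?Q = "{S\<in>Pow I. E \<inter> \<Inter>(h ` S) \<noteq> {}}"
  have fin: "finite ?P" using finite_intersections[OF I] by auto
  have "charpoly E B = (\<Sum>F\<in>?P. \<Sum>S\<in>{S\<in>?Q. E \<inter> \<Inter>(h ` S) = F}. (-1) ^ card S * flat_monom (E \<inter> \<Inter>(h ` S)))"
    unfolding charpoly_def flats
  proof (rule sum.cong)
    fix F assume F: "F \<in> ?P"
    have "monom (of_int (moebius ?P E F)) (nat (aff_dim F)) = of_int (moebius ?P E F) * flat_monom F"
      using F by (simp add: flat_monom_def of_int_poly smult_monom)
    also have "\<dots> = (\<Sum>S\<in>{S\<in>Pow I. E \<inter> \<Inter>(h ` S) = F}. (-1) ^ card S * flat_monom F)"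
      using moebius_eq_sum[OF I proper F] by (simp add: sum_distrib_right)
    also have "\<dots> = (\<Sum>S\<in>{S\<in>?Q. E \<inter> \<Inter>(h ` S) = F}. (-1) ^ card S * flat_monom (E \<inter> \<Inter>(h ` S)))"
      using F by (intro sum.cong) auto
    finally show "monom (of_int (moebius ?P E F)) (nat (aff_dim F)) =
      (\<Sum>S\<in>{S\<in>?Q. E \<inter> \<Inter>(h ` S) = F}. (-1) ^ card S * flat_monom (E \<inter> \<Inter>(h ` S)))" .
  qed simp
  also have "\<dots> = (\<Sum>S\<in>?Q. (-1) ^ card S * flat_monom (E \<inter> \<Inter>(h ` S)))"
    by (rule sum.group) (use I fin in \<open>auto simp: intersections_def\<close>)
  also have "\<dots> = whitney flat_monom E I h"
    unfolding whitney_def by (rule sum.mono_neutral_left) (use I in \<open>auto simp: flat_monom_def\<close>)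
  finally show ?thesis .
qed

lemma poly_whitney: "poly (whitney \<phi> E I h) x = whitney (\<lambda>F. poly (\<phi> F) x) E I h"
  by (simp add: whitney_def poly_sum)


subsection \<open>Counting chambers\<close>

definition affine_hyp :: "('i \<Rightarrow> 'a::euclidean_space) \<Rightarrow> ('i \<Rightarrow> real) \<Rightarrow> 'i \<Rightarrow> 'a set" where
  "affine_hyp w a i = {x. w i \<bullet> x = a i}"

definition signs :: "('i \<Rightarrow> 'a::euclidean_space) \<Rightarrow> ('i \<Rightarrow> real) \<Rightarrow> 'i set \<Rightarrow> 'a \<Rightarrow> 'i \<Rightarrow> real" where
  "signs w a J x = (\<lambda>i. if i \<in> J then sgn (w i \<bullet> x - a i) else 0)"

definition generic :: "('i \<Rightarrow> 'a::euclidean_space) \<Rightarrow> ('i \<Rightarrow> real) \<Rightarrow> 'i set \<Rightarrow> 'a set \<Rightarrow> 'a set" where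
  "generic w a J E = {x\<in>E. \<forall>i\<in>J. w i \<bullet> x \<noteq> a i}"

text \<open>A chamber is represented by the sign vector of its points.\<close>

definition chambers :: "('i \<Rightarrow> 'a::euclidean_space) \<Rightarrow> ('i \<Rightarrow> real) \<Rightarrow> 'i set \<Rightarrow> 'a set \<Rightarrow> ('i \<Rightarrow> real) set" where
  "chambers w a J E = signs w a J ` generic w a J E"

lemma finite_range_signs:
  assumes "finite J"
  shows "finite (range (signs w a J))"
proof (rule finite_subset)
  show "range (signs w a J) \<subseteq> {f. \<forall>i. (i \<in> J \<longrightarrow> f i \<in> {-1, 0, 1}) \<and> (i \<notin> J \<longrightarrow> f i = 0)}"
    by (auto simp: signs_def sgn_real_def split: if_splits)
  show "finite {f. \<forall>i. (i \<in> J \<longrightarrow> f i \<in> {-1, 0, 1::real}) \<and> (i \<notin> J \<longrightarrow> f i = 0)}"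
    by (rule finite_set_of_finite_funs) (use assms in auto)
qed

lemma finite_chambers: "finite J \<Longrightarrow> finite (chambers w a J E)"
  unfolding chambers_def by (rule finite_subset[OF _ finite_range_signs]) auto

text \<open>A change smaller than the absolute value of a number preserves its sign, and a finite
  minimum of positive bounds is positive.\<close>

lemma sgn_perturb:
  fixes p q :: "'i \<Rightarrow> real"
  assumes "finite J" "\<And>j. j \<in> J \<Longrightarrow> p j \<noteq> 0"
  obtains \<delta> where "\<delta> > 0" "\<And>j s. j \<in> J \<Longrightarrow> \<bar>s\<bar> \<le> \<delta> \<Longrightarrow> sgn (p j + s * q j) = sgn (p j)"
proof -
  have "\<exists>\<delta>>0. \<forall>j\<in>J. \<forall>s. \<bar>s\<bar> \<le> \<delta> \<longrightarrow> sgn (p j + s * q j) = sgn (p j)"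
    using assms
  proof (induction J rule: finite_induct)
    case empty
    show ?case by (intro exI[of _ 1]) auto
  next
    case (insert k J)
    then obtain \<delta> where \<delta>: "\<delta> > 0" "\<forall>j\<in>J. \<forall>s. \<bar>s\<bar> \<le> \<delta> \<longrightarrow> sgn (p j + s * q j) = sgn (p j)"
      by auto
    \<comment> \<open>The added 1 keeps the denominator positive when \<open>q k = 0\<close> and
      makes the estimate strict.\<close>
    define \<epsilon> where "\<epsilon> = \<bar>p k\<bar> / (\<bar>q k\<bar> + 1)"
    have pk: "\<bar>p k\<bar> > 0" using insert.prems by auto
    have \<epsilon>: "\<epsilon> > 0" using pk by (simp add: \<epsilon>_def add_nonneg_pos)
    have "sgn (p k + s * q k) = sgn (p k)" if s: "\<bar>s\<bar> \<le> \<epsilon>" for s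
    proof -
      have "\<bar>s * q k\<bar> \<le> \<epsilon> * \<bar>q k\<bar>" using s by (simp add: abs_mult mult_right_mono)
      also have "\<dots> < \<epsilon> * (\<bar>q k\<bar> + 1)" using \<epsilon> by simp
      also have "\<dots> = \<bar>p k\<bar>" unfolding \<epsilon>_def by (simp add: add_nonneg_pos)
      finally show ?thesis by (auto simp: sgn_if abs_if split: if_splits)
    qed
    then show ?case using \<delta> \<epsilon> by (intro exI[of _ "min \<delta> \<epsilon>"]) auto
  qed
  then show ?thesis using that by blast
qed

text \<open>Chambers are convex: \<open>w i \<bullet> x - a i\<close> is affine along the segment,
  and convex combinations of two numbers of one nonzero sign keep that sign.\<close>

lemma signs_segment:
  assumes "x \<in> generic w a J UNIV" "signs w a J y = signs w a J x" "0 \<le> t" "t \<le> 1"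
  shows "signs w a J ((1 - t) *\<^sub>R x + t *\<^sub>R y) = signs w a J x"
    and "(1 - t) *\<^sub>R x + t *\<^sub>R y \<in> generic w a J UNIV"
proof -
  let ?z = "(1 - t) *\<^sub>R x + t *\<^sub>R y"
  have *: "sgn (w i \<bullet> ?z - a i) = sgn (w i \<bullet> x - a i) \<and> w i \<bullet> x - a i \<noteq> 0" if "i \<in> J" for i
  proof -
    let ?p = "w i \<bullet> x - a i" and ?q = "w i \<bullet> y - a i"
    have eq: "w i \<bullet> ?z - a i = (1 - t) * ?p + t * ?q" by (simp add: inner_add_right algebra_simps)
    have p: "?p \<noteq> 0" using assms(1) that by (auto simp: generic_def)
    have "sgn ?q = sgn ?p" using fun_cong[OF assms(2), of i] that by (simp add: signs_def)
    then consider "?p > 0" "?q > 0" | "?p < 0" "?q < 0" using p by (auto simp: sgn_if split: if_splits)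
    then have "sgn ((1 - t) * ?p + t * ?q) = sgn ?p"
    proof cases
      case 1
      then have "(1 - t) * ?p + t * ?q > 0"
        using assms(3,4) by (cases "t = 0") (auto intro: add_nonneg_pos)
      then show ?thesis using 1 by simp
    next
      case 2
      then have "(1 - t) * (- ?p) + t * (- ?q) > 0"
        using assms(3,4) by (cases "t = 0") (auto intro: add_nonneg_pos simp del: mult_minus_right)
      then have "(1 - t) * ?p + t * ?q < 0" by (simp add: algebra_simps)
      then show ?thesis using 2 by simp
    qed
    then show ?thesis using eq p by simp
  qed
  show "signs w a J ?z = signs w a J x" using * by (auto simp: signs_def)
  show "?z \<in> generic w a J UNIV" using * by (auto simp: generic_def) (metis sgn_0 sgn_0_0 right_minus_eq)
qed

lemma signs_perturb:
  assumes "finite J" "x \<in> generic w a J UNIV"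
  obtains \<delta> where "\<delta> > 0"
    "\<And>s. \<bar>s\<bar> \<le> \<delta> \<Longrightarrow> signs w a J (x + s *\<^sub>R d) = signs w a J x \<and> x + s *\<^sub>R d \<in> generic w a J UNIV"
proof -
  have ne: "w j \<bullet> x - a j \<noteq> 0" if "j \<in> J" for j using assms(2) that by (auto simp: generic_def)
  obtain \<delta> where \<delta>: "\<delta> > 0" "\<And>j s. j \<in> J \<Longrightarrow> \<bar>s\<bar> \<le> \<delta> \<Longrightarrow>
      sgn (w j \<bullet> x - a j + s * (w j \<bullet> d)) = sgn (w j \<bullet> x - a j)"
    using sgn_perturb[OF assms(1), of "\<lambda>j. w j \<bullet> x - a j" "\<lambda>j. w j \<bullet> d"] ne by blast
  show ?thesis
  proof (rule that[OF \<delta>(1)])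
    fix s :: real assume s: "\<bar>s\<bar> \<le> \<delta>"
    have *: "sgn (w j \<bullet> (x + s *\<^sub>R d) - a j) = sgn (w j \<bullet> x - a j)" if "j \<in> J" for j
      using \<delta>(2)[OF that s] by (simp add: inner_add_right algebra_simps)
    have "w j \<bullet> (x + s *\<^sub>R d) \<noteq> a j" if "j \<in> J" for j
      using *[OF that] ne[OF that] by (metis sgn_0 sgn_0_0 right_minus_eq)
    then show "signs w a J (x + s *\<^sub>R d) = signs w a J x \<and> x + s *\<^sub>R d \<in> generic w a J UNIV"
      using * by (auto simp: signs_def generic_def)
  qed
qed

text \<open>A chamber of \<open>J\<close> meets the positive side \<open>Q 1\<close> of the new
  hyperplane, the negative side \<open>Q (-1)\<close>, or both. It meets both exactly when the
  hyperplane passes through it, and then it splits in two.\<close>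

lemma chambers_insert_halves:
  fixes w :: "'i \<Rightarrow> 'a::euclidean_space"
  assumes E: "affine E" and J: "finite J" and i: "i \<notin> J" and proper: "\<not> E \<subseteq> affine_hyp w a i"
  defines "Q \<equiv> \<lambda>k. {x\<in>generic w a J E. sgn (w i \<bullet> x - a i) = k}"
  shows "card (chambers w a (insert i J) E) = card (signs w a J ` Q 1) + card (signs w a J ` Q (-1))"
    and "signs w a J ` Q 1 \<union> signs w a J ` Q (-1) = chambers w a J E"
    and "signs w a J ` Q 1 \<inter> signs w a J ` Q (-1) = chambers w a J (E \<inter> affine_hyp w a i)"
proof -
  \<comment> \<open>The line from a point of the hyperplane to \<open>y\<close> stays in
    \<open>E\<close> and crosses the hyperplane, so it reaches both sides.\<close>
  obtain y where y: "y \<in> E" "w i \<bullet> y \<noteq> a i" using proper by (auto simp: affine_hyp_def)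
  have line: "x + s *\<^sub>R (y - x) \<in> E" if "x \<in> E" for x s
    using E that y(1) mem_affine[of E x y "1 - s" s] by (simp add: algebra_simps)
  have Qfin: "finite (signs w a J ` Q k)" for k
    by (rule finite_subset[OF _ finite_range_signs[OF J]]) auto
  have upd: "signs w a (insert i J) ` Q k = (\<lambda>s. s(i := k)) ` signs w a J ` Q k" for k
    unfolding image_image by (rule image_cong) (use i in \<open>auto simp: Q_def signs_def\<close>)
  have inj: "inj_on (\<lambda>s. s(i := k)) (signs w a J ` Q k)" for k
  proof (rule inj_on_inverseI[where g = "\<lambda>s. s(i := 0)"])
    fix s assume "s \<in> signs w a J ` Q k"
    then show "(s(i := k))(i := 0) = s" using i by (auto simp: signs_def)
  qed
  have split: "chambers w a (insert i J) E = signs w a (insert i J) ` Q 1 \<union> signs w a (insert i J) ` Q (-1)"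
  proof -
    have "generic w a (insert i J) E = Q 1 \<union> Q (-1)"
      by (auto simp: generic_def Q_def sgn_if)
    then show ?thesis by (simp add: chambers_def image_Un)
  qed
  have "signs w a (insert i J) ` Q 1 \<inter> signs w a (insert i J) ` Q (-1) = {}"
    unfolding upd by (auto dest: fun_cong[of _ _ i])
  then show "card (chambers w a (insert i J) E) = card (signs w a J ` Q 1) + card (signs w a J ` Q (-1))"
    unfolding split using Qfin by (subst card_Un_disjoint) (auto simp: upd card_image[OF inj])
  have perturbed: "\<exists>u\<in>Q 1. \<exists>v\<in>Q (-1). signs w a J u = signs w a J x \<and> signs w a J v = signs w a J x"
    if x: "x \<in> generic w a J E" "w i \<bullet> x = a i" for x
  proof -
    have xE: "x \<in> E" "x \<in> generic w a J UNIV" using x by (auto simp: generic_def)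
    obtain \<delta> where \<delta>: "\<delta> > 0" "\<And>s. \<bar>s\<bar> \<le> \<delta> \<Longrightarrow> signs w a J (x + s *\<^sub>R (y - x)) = signs w a J x \<and>
        x + s *\<^sub>R (y - x) \<in> generic w a J UNIV"
      using signs_perturb[OF J xE(2)] by metis
    let ?z = "\<lambda>s. x + s *\<^sub>R (y - x)"
    define s where "s = \<delta> * sgn (w i \<bullet> y - a i)"
    have val: "w i \<bullet> ?z r - a i = r * (w i \<bullet> y - a i)" for r
      using x(2) by (simp add: inner_add_right inner_diff_right)
    have "\<bar>s\<bar> \<le> \<delta>" "\<bar>- s\<bar> \<le> \<delta>" using \<delta>(1) by (auto simp: s_def abs_mult sgn_if)
    moreover have "sgn (s * (w i \<bullet> y - a i)) = 1" "sgn (- s * (w i \<bullet> y - a i)) = -1"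
      using \<delta>(1) y(2) by (auto simp: s_def sgn_real_def mult_less_0_iff zero_less_mult_iff)
    moreover have "?z s \<in> E" "?z (- s) \<in> E" using line[OF xE(1), of s] line[OF xE(1), of "- s"] by auto
    ultimately have "?z s \<in> Q 1" "?z (- s) \<in> Q (-1)"
      using \<delta>(2)[of s] \<delta>(2)[of "- s"] val[of s] val[of "- s"] by (auto simp: Q_def generic_def)
    then show ?thesis using \<delta>(2)[of s] \<delta>(2)[of "- s"] \<open>\<bar>s\<bar> \<le> \<delta>\<close> \<open>\<bar>- s\<bar> \<le> \<delta>\<close> by blast
  qed
  show "signs w a J ` Q 1 \<union> signs w a J ` Q (-1) = chambers w a J E"
  proof (intro subset_antisym subsetI)
    fix f assume "f \<in> chambers w a J E"
    then obtain x where x: "x \<in> generic w a J E" "f = signs w a J x" by (auto simp: chambers_def)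
    show "f \<in> signs w a J ` Q 1 \<union> signs w a J ` Q (-1)"
    proof (cases "w i \<bullet> x = a i")
      case True
      then show ?thesis using perturbed[OF x(1)] x(2) by (metis UnI1 imageI)
    next
      case False
      then have "x \<in> Q 1 \<or> x \<in> Q (-1)" using x(1) by (auto simp: Q_def sgn_if)
      then show ?thesis using x(2) by auto
    qed
  qed (auto simp: chambers_def Q_def)
  show "signs w a J ` Q 1 \<inter> signs w a J ` Q (-1) = chambers w a J (E \<inter> affine_hyp w a i)"
  proof (intro subset_antisym subsetI)
    fix f assume "f \<in> signs w a J ` Q 1 \<inter> signs w a J ` Q (-1)"
    then obtain u v where u: "u \<in> Q 1" "f = signs w a J u" and v: "v \<in> Q (-1)" "signs w a J v = signs w a J u"
      by auto
    let ?p = "w i \<bullet> u - a i" and ?q = "w i \<bullet> v - a i"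
    have pq: "?p > 0" "?q < 0" using u v by (auto simp: Q_def sgn_if split: if_splits)
    \<comment> \<open>The parameter at which the segment from \<open>u\<close> to \<open>v\<close>
      crosses the hyperplane; by convexity the crossing point has the same sign vector.\<close>
    define t where "t = ?p / (?p - ?q)"
    have t: "0 \<le> t" "t \<le> 1" using pq by (auto simp: t_def)
    let ?z = "(1 - t) *\<^sub>R u + t *\<^sub>R v"
    have "w i \<bullet> ?z - a i = ?p - t * (?p - ?q)" by (simp add: inner_add_right algebra_simps)
    also have "\<dots> = 0" using pq by (simp add: t_def)
    finally have "w i \<bullet> ?z = a i" by simp
    moreover have "?z \<in> E" using u v E by (intro mem_affine) (auto simp: Q_def generic_def)
    moreover have "u \<in> generic w a J UNIV" using u by (auto simp: Q_def generic_def)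
    note signs_segment[OF this v(2) t]
    ultimately show "f \<in> chambers w a J (E \<inter> affine_hyp w a i)"
      using u(2) unfolding chambers_def by (intro image_eqI[of _ _ ?z]) (auto simp: generic_def affine_hyp_def)
  next
    fix f assume "f \<in> chambers w a J (E \<inter> affine_hyp w a i)"
    then obtain x where "x \<in> generic w a J E" "w i \<bullet> x = a i" "f = signs w a J x"
      by (auto simp: chambers_def generic_def affine_hyp_def)
    then show "f \<in> signs w a J ` Q 1 \<inter> signs w a J ` Q (-1)"
      using perturbed by (metis IntI imageI)
  qed
qed

text \<open>Inclusion and exclusion for the two halves: chambers cut by the new hyperplane are
  counted twice.\<close>

lemma card_chambers_insert:
  assumes "affine E" "finite J" "i \<notin> J" "\<not> E \<subseteq> affine_hyp w a i"
  shows "card (chambers w a (insert i J) E) =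
    card (chambers w a J E) + card (chambers w a J (E \<inter> affine_hyp w a i))"
proof -
  note halves = chambers_insert_halves[OF assms]
  have "finite (chambers w a J E)" using assms(2) by (rule finite_chambers)
  then have "finite (signs w a J ` {x\<in>generic w a J E. sgn (w i \<bullet> x - a i) = 1})"
    "finite (signs w a J ` {x\<in>generic w a J E. sgn (w i \<bullet> x - a i) = -1})"
    unfolding halves(2)[symmetric] by auto
  from card_Un_Int[OF this] show ?thesis using halves by simp
qed

text \<open>By deletion and restriction, adding a hyperplane never lowers the number of chambers,
  which starts at one.\<close>

lemma chambers_nonempty:
  assumes "affine E" "E \<noteq> {}" "finite J" "\<And>i. i \<in> J \<Longrightarrow> \<not> E \<subseteq> affine_hyp w a i"
  shows "card (chambers w a J E) > 0"
  using assms(3,4)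
proof (induction J rule: finite_induct)
  case empty
  have "chambers w a {} E = {\<lambda>_. 0}" using assms(2) by (auto simp: chambers_def generic_def signs_def)
  then show ?case by simp
next
  case (insert i J)
  then show ?case using card_chambers_insert[OF assms(1), of J i w a] by simp
qed

section \<open>Zaslavsky's theorem\<close>

definition flat_sign :: "'a::euclidean_space set \<Rightarrow> real" where
  "flat_sign F = (if F = {} then 0 else (-1) ^ nat (aff_dim F))"

lemma poly_flat_monom: "poly (flat_monom F) (-1) = flat_sign F"
  by (simp add: flat_monom_def flat_sign_def poly_monom)

text \<open>Both sides obey deletion and restriction; the sign of the dimension turns the difference
  of Whitney sums into a sum of chamber counts.\<close>

lemma zaslavsky:
  fixes w :: "'i \<Rightarrow> 'a::euclidean_space"
  assumes "finite J" "affine E"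
  shows "real (card (chambers w a J E)) =
    (-1) ^ nat (aff_dim E) * whitney flat_sign E J (affine_hyp w a)"
  using assms
proof (induction J arbitrary: E rule: finite_induct)
  case empty
  show ?case
  proof (cases "E = {}")
    case True
    then show ?thesis by (simp add: chambers_def generic_def flat_sign_def)
  next
    case False
    then have "chambers w a {} E = {\<lambda>_. 0}" by (auto simp: chambers_def generic_def signs_def)
    then show ?thesis using False by (simp add: flat_sign_def flip: power_mult_distrib)
  qed
next
  case (insert i J)
  let ?h = "affine_hyp w a"
  show ?case
  proof (cases "E \<subseteq> ?h i")
    case True
    then have "chambers w a (insert i J) E = {}" by (auto simp: chambers_def generic_def affine_hyp_def)
    moreover have "whitney flat_sign E (insert i J) ?h = 0"
      using True insert.hyps by (intro whitney_eq_0) auto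
    ultimately show ?thesis by simp
  next
    case False
    have aff: "affine (E \<inter> ?h i)"
      unfolding affine_hyp_def using insert.prems by (intro affine_Int affine_hyperplane)
    \<comment> \<open>A nonempty proper section loses one dimension, which supplies the minus sign;
      for an empty section both sides are 0.\<close>
    have "(-1) ^ nat (aff_dim (E \<inter> ?h i)) * whitney flat_sign (E \<inter> ?h i) J ?h =
      - ((-1) ^ nat (aff_dim E) * whitney flat_sign (E \<inter> ?h i) J ?h)"
    proof (cases "E \<inter> ?h i = {}")
      case True
      then show ?thesis by (simp add: whitney_empty_space flat_sign_def)
    next
      case nonempty: False
      then have "aff_dim (E \<inter> ?h i) = aff_dim E - 1"
        using aff_dim_affine_Int_hyperplane[OF insert.prems, of "w i" "a i"] False
        by (auto simp: affine_hyp_def)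
      moreover have "aff_dim (E \<inter> ?h i) \<ge> 0" using nonempty by (metis aff_dim_negative_iff not_less)
      ultimately have "nat (aff_dim E) = Suc (nat (aff_dim (E \<inter> ?h i)))" by simp
      then show ?thesis by simp
    qed
    moreover have "card (chambers w a (insert i J) E) =
        card (chambers w a J E) + card (chambers w a J (E \<inter> ?h i))"
      using insert False by (intro card_chambers_insert)
    ultimately show ?thesis
      using insert.IH[OF insert.prems] insert.IH[OF aff] insert.hyps
      by (simp add: whitney_insert right_diff_distrib)
  qed
qed


subsection \<open>Faces of the central arrangement\<close>

text \<open>Any common point \<open>x\<close> translates the linear intersection onto the affine
  one.\<close>

lemma aff_dim_Inter_affine_hyp:
  assumes "\<Inter>(affine_hyp w a ` S) \<noteq> {}"
  shows "aff_dim (\<Inter>(affine_hyp w a ` S)) = aff_dim (\<Inter>(affine_hyp w (\<lambda>_. 0) ` S))"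
proof -
  obtain x where x: "\<And>i. i \<in> S \<Longrightarrow> w i \<bullet> x = a i"
    using assms by (auto simp: affine_hyp_def)
  have "\<Inter>(affine_hyp w a ` S) = (+) x ` \<Inter>(affine_hyp w (\<lambda>_. 0) ` S)"
  proof (intro subset_antisym subsetI)
    fix y assume "y \<in> \<Inter>(affine_hyp w a ` S)"
    then have "y - x \<in> \<Inter>(affine_hyp w (\<lambda>_. 0) ` S)"
      using x by (auto simp: affine_hyp_def inner_diff_right)
    then show "y \<in> (+) x ` \<Inter>(affine_hyp w (\<lambda>_. 0) ` S)"
      by (rule rev_image_eqI) simp
  qed (use x in \<open>auto simp: affine_hyp_def inner_add_right\<close>)
  then show ?thesis by (simp add: aff_dim_translation_eq)
qed

lemma subspace_Inter_affine_hyp: "subspace (\<Inter>(affine_hyp w (\<lambda>_. 0) ` S))"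
  by (rule subspace_Inter) (auto simp: affine_hyp_def subspace_hyperplane)

lemma flat_sign_square: "X \<noteq> {} \<Longrightarrow> flat_sign X * flat_sign X = 1"
  by (simp add: flat_sign_def flip: power_mult_distrib)

text \<open>The face order of a central arrangement: the face \<open>\<sigma>\<close> lies in the
  closure of \<open>\<tau>\<close>. When \<open>\<tau>\<close> is a chamber of the affine
  arrangement, it says that the face lies in the recession cone.\<close>

definition face_le :: "('i \<Rightarrow> real) \<Rightarrow> ('i \<Rightarrow> real) \<Rightarrow> bool" where
  "face_le \<sigma> \<tau> \<longleftrightarrow> (\<forall>i. \<sigma> i \<noteq> 0 \<longrightarrow> \<tau> i = \<sigma> i)"

lemma face_le_trans: "face_le \<rho> \<sigma> \<Longrightarrow> face_le \<sigma> \<tau> \<Longrightarrow> face_le \<rho> \<tau>"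
  by (simp add: face_le_def)

text \<open>\<open>hyp\<close> and \<open>lin\<close> share their index set, so parallel hyperplanes
  stay distinct indices even where their \<open>lin\<close> coincide.\<close>

locale affine_family =
  fixes w :: "'i \<Rightarrow> 'a::euclidean_space" and a :: "'i \<Rightarrow> real" and I :: "'i set"
  assumes finite_I: "finite I"
begin

abbreviation hyp where "hyp \<equiv> affine_hyp w a"
abbreviation lin where "lin \<equiv> affine_hyp w (\<lambda>_. 0)"
abbreviation face where "face \<equiv> signs w (\<lambda>_. 0) I"
abbreviation zeros where "zeros v \<equiv> {i\<in>I. w i \<bullet> v = 0}"

text \<open>For the sign vector of a face this is the span of the face.\<close>

definition flat :: "('i \<Rightarrow> real) \<Rightarrow> 'a set" where
  "flat \<tau> = \<Inter>(lin ` {i\<in>I. \<tau> i = 0})"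

lemma face_eq_0_iff: "face v i = 0 \<longleftrightarrow> i \<notin> I \<or> w i \<bullet> v = 0"
  by (simp add: signs_def sgn_0_0)

lemma flat_face: "flat (face v) = \<Inter>(lin ` zeros v)"
proof -
  have "{i\<in>I. face v i = 0} = zeros v" by (auto simp: face_eq_0_iff)
  then show ?thesis by (simp add: flat_def)
qed

lemma in_flat_face: "v \<in> flat (face v)"
  unfolding flat_face by (auto simp: affine_hyp_def)

text \<open>Outside \<open>zeros v\<close> the signs are prescribed by \<open>v\<close>, so
  forgetting them is injective. It is onto because a point moved far in direction \<open>v\<close>
  acquires these signs and keeps those on \<open>zeros v\<close>.\<close>

lemma card_chambers_above:
  "card {\<epsilon>\<in>chambers w a I UNIV. face_le (face v) \<epsilon>} = card (chambers w a (zeros v) UNIV)"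
proof -
  let ?Z = "zeros v"
  let ?A = "{\<epsilon>\<in>chambers w a I UNIV. face_le (face v) \<epsilon>}"
  define r where "r f = (\<lambda>i. if i \<in> ?Z then f i else 0)" for f :: "'i \<Rightarrow> real"
  have r: "r (signs w a I x) = signs w a ?Z x" for x by (auto simp: r_def signs_def)
  have "inj_on r ?A"
  proof (rule inj_onI)
    fix f g assume f: "f \<in> ?A" and g: "g \<in> ?A" and eq: "r f = r g"
    have "f i = g i" for i
    proof -
      consider "i \<in> ?Z" | "i \<notin> I" | "face v i \<noteq> 0" using face_eq_0_iff by blast
      then show ?thesis
      proof cases
        case 1
        then show ?thesis using fun_cong[OF eq, of i] by (simp add: r_def)
      qed (use f g in \<open>auto simp: chambers_def signs_def face_le_def\<close>)
    qed
    then show "f = g" by auto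
  qed
  moreover have "r ` ?A = chambers w a ?Z UNIV"
  proof (intro subset_antisym subsetI)
    fix f assume "f \<in> r ` ?A"
    then obtain x where "x \<in> generic w a I UNIV" "f = signs w a ?Z x"
      by (auto simp: chambers_def r)
    then show "f \<in> chambers w a ?Z UNIV" by (auto simp: chambers_def generic_def)
  next
    fix f assume "f \<in> chambers w a ?Z UNIV"
    then obtain x where x: "x \<in> generic w a ?Z UNIV" "f = signs w a ?Z x"
      by (auto simp: chambers_def)
    obtain \<delta> where \<delta>: "\<delta> > 0" "\<And>j s. j \<in> I - ?Z \<Longrightarrow> \<bar>s\<bar> \<le> \<delta> \<Longrightarrow>
        sgn (w j \<bullet> v + s * (w j \<bullet> x - a j)) = sgn (w j \<bullet> v)"
      using sgn_perturb[of "I - ?Z" "\<lambda>j. w j \<bullet> v" "\<lambda>j. w j \<bullet> x - a j"] finite_I by blast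
    \<comment> \<open>The move is long enough that, after rescaling by \<open>\<delta>\<close>,
      \<open>w j \<bullet> x - a j\<close> is only a small perturbation of
      \<open>w j \<bullet> v\<close>.\<close>
    define y where "y = x + (1 / \<delta>) *\<^sub>R v"
    have Z: "w j \<bullet> y = w j \<bullet> x" if "j \<in> ?Z" for j using that by (simp add: y_def inner_add_right)
    have NZ: "sgn (w j \<bullet> y - a j) = sgn (w j \<bullet> v)" if j: "j \<in> I - ?Z" for j
    proof -
      have "w j \<bullet> y - a j = (1 / \<delta>) * (w j \<bullet> v + \<delta> * (w j \<bullet> x - a j))"
        using \<delta>(1) by (simp add: y_def inner_add_right field_simps)
      then show ?thesis using \<delta>(2)[OF j, of \<delta>] \<delta>(1) by (simp only: sgn_mult) simp
    qed
    have "y \<in> generic w a I UNIV"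
    proof -
      have "w j \<bullet> y \<noteq> a j" if "j \<in> I" for j
      proof (cases "j \<in> ?Z")
        case True
        then show ?thesis using Z[OF True] x(1) by (auto simp: generic_def)
      next
        case False
        then show ?thesis using NZ[of j] that by (auto simp: sgn_0_0)
      qed
      then show ?thesis by (simp add: generic_def)
    qed
    moreover have "face_le (face v) (signs w a I y)"
      using NZ by (auto simp: face_le_def signs_def sgn_0_0)
    moreover have "f = r (signs w a I y)" unfolding r x(2) using Z by (auto simp: signs_def)
    ultimately show "f \<in> r ` ?A" by (auto simp: chambers_def)
  qed
  ultimately show ?thesis using card_image[of r ?A] by (simp only:)
qed

text \<open>A face above \<open>face v\<close> that spans \<open>X\<close> is determined by its
  signs on the hyperplanes through \<open>v\<close> that do not contain \<open>X\<close>. Every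
  chamber of this restriction occurs, on points of \<open>X\<close> close to
  \<open>v\<close>.\<close>

lemma card_faces_above:
  assumes X: "X \<in> intersections UNIV (zeros v) lin"
  shows "card {\<tau>\<in>range face. face_le (face v) \<tau> \<and> flat \<tau> = X} =
    card (chambers w (\<lambda>_. 0) {i\<in>zeros v. \<not> X \<subseteq> lin i} X)"
proof -
  let ?Z = "zeros v" and ?K = "{i\<in>zeros v. \<not> X \<subseteq> lin i}"
  let ?A = "{\<tau>\<in>range face. face_le (face v) \<tau> \<and> flat \<tau> = X}"
  obtain S where S: "S \<subseteq> ?Z" "X = \<Inter>(lin ` S)" using X by (auto simp: intersections_def)
  have vX: "v \<in> X" using S by (auto simp: affine_hyp_def)
  have sub: "subspace X" unfolding S(2) by (rule subspace_Inter_affine_hyp)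
  have canon: "\<Inter>(lin ` {i\<in>I. X \<subseteq> lin i}) = X"
    using intersections_canonical[of X UNIV I lin] S by (auto simp: intersections_def)
  have linv: "i \<in> ?Z" if "i \<in> I" "X \<subseteq> lin i" for i using that vX by (auto simp: affine_hyp_def)
  define r where "r f = (\<lambda>i. if i \<in> ?K then f i else 0)" for f :: "'i \<Rightarrow> real"
  have r: "r (face x) = signs w (\<lambda>_. 0) ?K x" for x by (auto simp: r_def signs_def)
  have A: "\<exists>u\<in>X. \<tau> = face u" if "\<tau> \<in> ?A" for \<tau> using that in_flat_face by auto
  have "inj_on r ?A"
  proof (rule inj_onI)
    fix f g assume f: "f \<in> ?A" and g: "g \<in> ?A" and eq: "r f = r g"
    obtain u u' where u: "u \<in> X" "f = face u" "u' \<in> X" "g = face u'" using A[OF f] A[OF g] by auto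
    have "f i = g i" for i
    proof -
      consider "i \<in> ?K" | "i \<notin> I" | "X \<subseteq> lin i" | "face v i \<noteq> 0" using face_eq_0_iff by blast
      then show ?thesis
      proof cases
        case 1
        then show ?thesis using fun_cong[OF eq, of i] by (simp add: r_def)
      next
        case 3
        then have "w i \<bullet> u = 0" "w i \<bullet> u' = 0" using u by (auto simp: affine_hyp_def)
        then show ?thesis by (simp add: u signs_def)
      next
        case 4
        then show ?thesis using f g by (auto simp: face_le_def)
      qed (use u in \<open>auto simp: signs_def\<close>)
    qed
    then show "f = g" by auto
  qed
  moreover have "r ` ?A = chambers w (\<lambda>_. 0) ?K X"
  proof (intro subset_antisym subsetI)
    fix f assume "f \<in> r ` ?A"
    then obtain \<tau> where \<tau>: "\<tau> \<in> ?A" "f = r \<tau>" by auto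
    obtain u where u: "u \<in> X" "\<tau> = face u" using A[OF \<tau>(1)] by auto
    have flat: "\<Inter>(lin ` zeros u) = X" using \<tau>(1) u(2) flat_face by auto
    have "u \<in> generic w (\<lambda>_. 0) ?K X"
      unfolding generic_def
    proof (intro CollectI conjI ballI notI)
      fix i assume i: "i \<in> ?K" "w i \<bullet> u = 0"
      then have "X \<subseteq> lin i" unfolding flat[symmetric] by auto
      then show False using i by auto
    qed (rule u(1))
    then show "f \<in> chambers w (\<lambda>_. 0) ?K X" using \<tau>(2) u(2) r by (auto simp: chambers_def)
  next
    fix f assume "f \<in> chambers w (\<lambda>_. 0) ?K X"
    then obtain u where u: "u \<in> X" "\<And>i. i \<in> ?K \<Longrightarrow> w i \<bullet> u \<noteq> 0" "f = signs w (\<lambda>_. 0) ?K u"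
      by (auto simp: chambers_def generic_def)
    obtain \<delta> where \<delta>: "\<delta> > 0" "\<And>j s. j \<in> I - ?Z \<Longrightarrow> \<bar>s\<bar> \<le> \<delta> \<Longrightarrow>
        sgn (w j \<bullet> v + s * (w j \<bullet> u)) = sgn (w j \<bullet> v)"
      using sgn_perturb[of "I - ?Z" "\<lambda>j. w j \<bullet> v" "\<lambda>j. w j \<bullet> u"] finite_I by blast
    define y where "y = v + \<delta> *\<^sub>R u"
    have yX: "y \<in> X" unfolding y_def using sub vX u(1) by (intro subspace_add subspace_scale)
    have Z: "w j \<bullet> y = \<delta> * (w j \<bullet> u)" if "j \<in> ?Z" for j using that by (simp add: y_def inner_add_right)
    have NZ: "sgn (w j \<bullet> y) = sgn (w j \<bullet> v)" if "j \<in> I - ?Z" for j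
      using \<delta>(2)[OF that, of \<delta>] \<delta>(1) by (simp add: y_def inner_add_right)
    \<comment> \<open>The linear hyperplanes through \<open>y\<close> are exactly those containing
      \<open>X\<close>, so the face of \<open>y\<close> spans all of \<open>X\<close>.\<close>
    have "zeros y = {i\<in>I. X \<subseteq> lin i}"
    proof (intro subset_antisym subsetI)
      fix i assume i: "i \<in> zeros y"
      then have "i \<in> ?Z" using NZ[of i] by (auto simp: sgn_0_0)
      moreover from this have "w i \<bullet> u = 0" using Z[of i] i \<delta>(1) by auto
      ultimately show "i \<in> {i\<in>I. X \<subseteq> lin i}" using u(2)[of i] by auto
    qed (use yX in \<open>auto simp: affine_hyp_def\<close>)
    then have "flat (face y) = X" using canon by (simp add: flat_face)
    moreover have "face_le (face v) (face y)"
      using NZ by (auto simp: face_le_def signs_def sgn_0_0)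
    moreover have "f = r (face y)" unfolding r u(3) using Z \<delta>(1) by (auto simp: signs_def sgn_mult)
    ultimately show "f \<in> r ` ?A" by auto
  qed
  ultimately show ?thesis using card_image[of r ?A] by (simp only:)
qed

text \<open>Zaslavsky's theorem inside \<open>X\<close>, with \<open>flat_sign X\<close> its own
  inverse. The second part, which holds because the restriction has a chamber, permits division by
  the value at -1.\<close>

lemma whitney_flat_sign_intersection:
  assumes X: "X \<in> intersections UNIV (zeros v) lin"
  shows "whitney flat_sign X {i\<in>zeros v. \<not> X \<subseteq> lin i} lin =
    flat_sign X * real (card {\<tau>\<in>range face. face_le (face v) \<tau> \<and> flat \<tau> = X})"
    and "whitney flat_sign X {i\<in>zeros v. \<not> X \<subseteq> lin i} lin \<noteq> 0"
proof -
  let ?K = "{i\<in>zeros v. \<not> X \<subseteq> lin i}"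
  have sub: "subspace X"
    using X subspace_Inter_affine_hyp[of w] by (auto simp: intersections_def)
  then have aff: "affine X" "X \<noteq> {}" by (auto simp: subspace_imp_affine dest: subspace_0)
  have fin: "finite ?K" using finite_I by simp
  have "real (card (chambers w (\<lambda>_. 0) ?K X)) = flat_sign X * whitney flat_sign X ?K lin"
    using zaslavsky[OF fin aff(1)] aff(2) by (simp add: flat_sign_def)
  then have *: "flat_sign X * real (card (chambers w (\<lambda>_. 0) ?K X)) = whitney flat_sign X ?K lin"
    using flat_sign_square[OF aff(2)] by (simp add: mult.assoc[symmetric])
  then show "whitney flat_sign X ?K lin =
      flat_sign X * real (card {\<tau>\<in>range face. face_le (face v) \<tau> \<and> flat \<tau> = X})"
    using card_faces_above[OF X] by simp
  have "card (chambers w (\<lambda>_. 0) ?K X) > 0"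
    by (rule chambers_nonempty[OF aff fin]) auto
  then show "whitney flat_sign X ?K lin \<noteq> 0"
    using * aff(2) by (auto simp: flat_sign_def)
qed

subsection \<open>The largest face in the recession cone of a chamber\<close>

text \<open>The greatest face in the recession cone of the chamber; \<open>top_face_props\<close>
  shows that it exists, and antisymmetry of the face order makes it unique.\<close>

definition top_face :: "('i \<Rightarrow> real) \<Rightarrow> 'i \<Rightarrow> real" where
  "top_face \<epsilon> = (SOME \<tau>. \<tau> \<in> range face \<and> face_le \<tau> \<epsilon> \<and>
     (\<forall>\<sigma>\<in>range face. face_le \<sigma> \<epsilon> \<longrightarrow> face_le \<sigma> \<tau>))"

text \<open>Take \<open>v\<close> in the recession cone with fewest zeros. For any \<open>u\<close>
  in the cone, no coordinate of \<open>u + v\<close> cancels, so its zeros are the common zeros;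
  minimality then puts the zeros of \<open>v\<close> among those of \<open>u\<close>.\<close>

lemma top_face_props:
  "top_face \<epsilon> \<in> range face \<and> face_le (top_face \<epsilon>) \<epsilon> \<and>
    (\<forall>\<sigma>\<in>range face. face_le \<sigma> \<epsilon> \<longrightarrow> face_le \<sigma> (top_face \<epsilon>))"
proof -
  let ?P = "\<lambda>\<tau>. \<tau> \<in> range face \<and> face_le \<tau> \<epsilon> \<and>
    (\<forall>\<sigma>\<in>range face. face_le \<sigma> \<epsilon> \<longrightarrow> face_le \<sigma> \<tau>)"
  have "face_le (face 0) \<epsilon>" by (simp add: face_le_def signs_def)
  then obtain v where v: "face_le (face v) \<epsilon>"
    "\<And>u. face_le (face u) \<epsilon> \<Longrightarrow> card (zeros v) \<le> card (zeros u)"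
    using ex_has_least_nat[of "\<lambda>v. face_le (face v) \<epsilon>" 0 "\<lambda>v. card (zeros v)"] by auto
  have "face_le (face u) (face v)" if u: "face_le (face u) \<epsilon>" for u
  proof -
    have le: "sgn (w i \<bullet> x) = 0 \<or> sgn (w i \<bullet> x) = \<epsilon> i" if "i \<in> I" "face_le (face x) \<epsilon>" for i x
      using that(2)[unfolded face_le_def, rule_format, of i] that(1)
      by (cases "w i \<bullet> x = 0") (simp_all add: signs_def sgn_0_0)
    have sum: "(w i \<bullet> u = 0 \<and> w i \<bullet> v = 0 \<and> w i \<bullet> (u + v) = 0) \<or>
        (sgn (w i \<bullet> (u + v)) = \<epsilon> i \<and> w i \<bullet> (u + v) \<noteq> 0)" if "i \<in> I" for i
      using le[OF that u] le[OF that v(1)]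
      by (auto simp: inner_add_right sgn_real_def split: if_splits)
    have "face_le (face (u + v)) \<epsilon>"
      unfolding face_le_def
    proof (intro allI impI)
      fix i assume "face (u + v) i \<noteq> 0"
      then have "i \<in> I" "w i \<bullet> (u + v) \<noteq> 0" by (auto simp: face_eq_0_iff)
      then show "\<epsilon> i = face (u + v) i" using sum[of i] by (simp add: signs_def)
    qed
    then have "card (zeros v) \<le> card (zeros (u + v))" by (rule v(2))
    moreover have "zeros (u + v) \<subseteq> zeros v" using sum by blast
    ultimately have "zeros (u + v) = zeros v" using finite_I by (intro card_seteq) auto
    then have "zeros v \<subseteq> zeros u" using sum by blast
    then have "face u i \<noteq> 0 \<Longrightarrow> face v i \<noteq> 0" for i unfolding face_eq_0_iff by blast
    then show ?thesis using u v(1) unfolding face_le_def by metis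
  qed
  then have "?P (face v)" using v(1) by blast
  then have "?P (SOME \<tau>. ?P \<tau>)" by (rule someI[of ?P])
  then show ?thesis unfolding top_face_def .
qed

lemma top_face_in: "top_face \<epsilon> \<in> range face"
  using top_face_props by blast

lemma face_le_top_face: "\<sigma> \<in> range face \<Longrightarrow> face_le \<sigma> (top_face \<epsilon>) \<longleftrightarrow> face_le \<sigma> \<epsilon>"
  using top_face_props face_le_trans by blast

text \<open>The top face is open in its flat: for \<open>t\<close> in it and \<open>u\<close> in the
  flat, a small step from \<open>t\<close> along \<open>u\<close> stays in the face, so
  \<open>u\<close> is a multiple of a difference of two vectors of the cone. Conversely, every face
  in the cone lies below the top face.\<close>

lemma span_cone:
  assumes \<epsilon>: "\<epsilon> \<in> chambers w a I UNIV"
  shows "span {v. \<forall>i\<in>I. 0 \<le> \<epsilon> i * (w i \<bullet> v)} = flat (top_face \<epsilon>)"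
proof -
  have pm: "\<epsilon> i = 1 \<or> \<epsilon> i = -1" if "i \<in> I" for i
    using \<epsilon> that by (auto simp: chambers_def generic_def signs_def sgn_real_def split: if_splits)
  have cone: "(\<forall>i\<in>I. 0 \<le> \<epsilon> i * (w i \<bullet> v)) \<longleftrightarrow> face_le (face v) \<epsilon>" for v
  proof -
    have "0 \<le> \<epsilon> i * (w i \<bullet> v) \<longleftrightarrow> (w i \<bullet> v \<noteq> 0 \<longrightarrow> \<epsilon> i = sgn (w i \<bullet> v))" if "i \<in> I" for i
      using pm[OF that] by (auto simp: sgn_real_def)
    then show ?thesis by (auto simp: face_le_def signs_def sgn_0_0)
  qed
  obtain t where t: "top_face \<epsilon> = face t" using top_face_in by auto
  have sub: "subspace (flat (face t))" unfolding flat_def by (rule subspace_Inter_affine_hyp)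
  show ?thesis unfolding cone t
  proof (rule span_unique)
    show "{v. face_le (face v) \<epsilon>} \<subseteq> flat (face t)"
    proof (intro subsetI)
      fix v assume "v \<in> {v. face_le (face v) \<epsilon>}"
      then have "face_le (face v) (face t)" using face_le_top_face[of "face v" \<epsilon>] t by simp
      then have "zeros t \<subseteq> zeros v" by (auto simp: face_le_def signs_def sgn_0_0 split: if_splits)
      then show "v \<in> flat (face t)" unfolding flat_face by (auto simp: affine_hyp_def)
    qed
  next
    fix T assume T: "{v. face_le (face v) \<epsilon>} \<subseteq> T" "subspace T"
    have tT: "t \<in> T" using T(1) top_face_props[of \<epsilon>] t by auto
    show "flat (face t) \<subseteq> T"
    proof
      fix u assume u: "u \<in> flat (face t)"
      obtain \<delta> where \<delta>: "\<delta> > 0" "\<And>j s. j \<in> I - zeros t \<Longrightarrow> \<bar>s\<bar> \<le> \<delta> \<Longrightarrow>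
          sgn (w j \<bullet> t + s * (w j \<bullet> u)) = sgn (w j \<bullet> t)"
        using sgn_perturb[of "I - zeros t" "\<lambda>j. w j \<bullet> t" "\<lambda>j. w j \<bullet> u"] finite_I by blast
      have "sgn (w j \<bullet> (t + \<delta> *\<^sub>R u)) = sgn (w j \<bullet> t)" if "j \<in> I" for j
      proof (cases "j \<in> zeros t")
        case True
        then have "w j \<bullet> u = 0" using u unfolding flat_face by (auto simp: affine_hyp_def)
        then show ?thesis by (simp add: inner_add_right)
      next
        case False
        then show ?thesis using \<delta>(2)[of j \<delta>] \<delta>(1) that by (simp add: inner_add_right)
      qed
      then have "face (t + \<delta> *\<^sub>R u) = face t" by (auto simp: signs_def)
      then have "t + \<delta> *\<^sub>R u \<in> T" using T(1) top_face_props[of \<epsilon>] t by auto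
      then have "(t + \<delta> *\<^sub>R u) - t \<in> T" using T(2) tT by (intro subspace_diff)
      then show "u \<in> T"
        using subspace_scale[OF T(2), of "\<delta> *\<^sub>R u" "1 / \<delta>"] \<delta>(1) by simp
    qed
  qed (rule sub)
qed

text \<open>The summand of the Whitney sum is the monomial \<open>t\<^sup>d\<close> at \<open>t = 1\<close>: this is the coefficient \<open>b(X)\<close>.\<close>

definition weight :: "'a set \<Rightarrow> int" where
  "weight X = whitney (\<lambda>F. if F = {} then 0 else 1) UNIV {i\<in>I. X \<subseteq> lin i} hyp"

text \<open>Faces strictly above \<open>face v\<close> have fewer zeros, so induction covers them.
  Both sides have the same sum over all faces above \<open>face v\<close>: the left one counts the
  chambers whose recession cone contains \<open>face v\<close>, and Zaslavsky's theorem with the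
  Whitney expansion turns this into the right one. Cancelling the known terms leaves
  \<open>face v\<close>.\<close>

lemma card_top_face:
  "real (card {\<epsilon>\<in>chambers w a I UNIV. top_face \<epsilon> = face v}) =
    (-1) ^ DIM('a) * flat_sign (flat (face v)) * of_int (weight (flat (face v)))"
proof (induction "card (zeros v)" arbitrary: v rule: less_induct)
  case less
  let ?C = "chambers w a I UNIV"
  let ?N = "\<lambda>\<tau>. card {\<epsilon>\<in>?C. top_face \<epsilon> = \<tau>}"
  let ?g = "\<lambda>\<tau>. (-1) ^ DIM('a) * flat_sign (flat \<tau>) * of_int (weight (flat \<tau>)) :: real"
  let ?U = "{\<tau>\<in>range face. face_le (face v) \<tau>}"
  let ?Z = "zeros v"
  let ?L = "intersections UNIV ?Z lin"
  have finC: "finite ?C" using finite_I by (rule finite_chambers)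
  have finU: "finite ?U" by (rule finite_subset[OF _ finite_range_signs[OF finite_I]]) auto
  have finZ: "finite ?Z" using finite_I by simp
  have vU: "face v \<in> ?U" by (simp add: face_le_def)
  have IH: "real (?N \<tau>) = ?g \<tau>" if \<tau>: "\<tau> \<in> ?U - {face v}" for \<tau>
  proof -
    obtain u where u: "\<tau> = face u" using \<tau> by auto
    have le: "face_le (face v) (face u)" "face u \<noteq> face v" using \<tau> u by auto
    then have "zeros u \<subseteq> ?Z" by (auto simp: face_le_def signs_def sgn_0_0 split: if_splits)
    moreover have "zeros u \<noteq> ?Z"
    proof
      assume eq: "zeros u = ?Z"
      have "face u i = face v i" for i
      proof (cases "face v i = 0")
        case True
        then have "i \<notin> I \<or> i \<in> zeros u" unfolding eq by (auto simp: signs_def sgn_0_0)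
        then show ?thesis using True by (auto simp: signs_def)
      next
        case False
        then show ?thesis using le by (simp add: face_le_def)
      qed
      then show False using le by auto
    qed
    ultimately have "card (zeros u) < card ?Z" using finZ by (intro psubset_card_mono) auto
    then show ?thesis unfolding u by (rule less.hyps)
  qed
  \<comment> \<open>Each chamber above \<open>face v\<close> is counted once, at its top face, which
    again lies above \<open>face v\<close>.\<close>
  have "(\<Sum>\<tau>\<in>?U. real (?N \<tau>)) = real (card {\<epsilon>\<in>?C. face_le (face v) \<epsilon>})"
  proof -
    have above: "face_le (face v) (top_face \<epsilon>) \<longleftrightarrow> face_le (face v) \<epsilon>" for \<epsilon>
      by (rule face_le_top_face) simp
    have fiber: "{\<epsilon>\<in>{\<epsilon>\<in>?C. face_le (face v) \<epsilon>}. top_face \<epsilon> = \<tau>} = {\<epsilon>\<in>?C. top_face \<epsilon> = \<tau>}" if "\<tau> \<in> ?U" for \<tau>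
      using that above by blast
    have "(\<Sum>\<tau>\<in>?U. real (?N \<tau>)) =
        (\<Sum>\<tau>\<in>?U. \<Sum>\<epsilon>\<in>{\<epsilon>\<in>{\<epsilon>\<in>?C. face_le (face v) \<epsilon>}. top_face \<epsilon> = \<tau>}. 1)"
    proof (rule sum.cong)
      fix \<tau> assume \<tau>: "\<tau> \<in> ?U"
      show "real (?N \<tau>) = (\<Sum>\<epsilon>\<in>{\<epsilon>\<in>{\<epsilon>\<in>?C. face_le (face v) \<epsilon>}. top_face \<epsilon> = \<tau>}. 1)"
        unfolding fiber[OF \<tau>] by simp
    qed simp
    also have "\<dots> = (\<Sum>\<epsilon>\<in>{\<epsilon>\<in>?C. face_le (face v) \<epsilon>}. 1)"
      by (rule sum.group) (use finC finU top_face_in above in auto)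
    finally show ?thesis by simp
  qed
  also have "\<dots> = real (card (chambers w a ?Z UNIV))" by (simp add: card_chambers_above)
  also have "\<dots> = (-1) ^ DIM('a) * whitney flat_sign UNIV ?Z hyp"
    using zaslavsky[OF finZ affine_UNIV] by simp
  also have "whitney flat_sign UNIV ?Z hyp = (\<Sum>X\<in>?L. of_int (weight X) * whitney flat_sign X {i\<in>?Z. \<not> X \<subseteq> lin i} lin)"
  proof (subst whitney_expansion[OF finZ, where l = lin])
    fix S assume "\<Inter>(hyp ` S) \<noteq> {}"
    moreover have "\<Inter>(lin ` S) \<noteq> {}" using subspace_0[OF subspace_Inter_affine_hyp[of w S]] by blast
    ultimately show "flat_sign (\<Inter>(hyp ` S)) = flat_sign (\<Inter>(lin ` S))"
      by (simp add: flat_sign_def aff_dim_Inter_affine_hyp[of w a S])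
  next
    \<comment> \<open>The hyperplanes containing \<open>X\<close> all contain \<open>v\<close>, so
      the coefficient does not change when the family is cut down to \<open>?Z\<close>.\<close>
    have "{i\<in>?Z. X \<subseteq> lin i} = {i\<in>I. X \<subseteq> lin i}" if X: "X \<in> ?L" for X
    proof -
      have "v \<in> X" using X by (auto simp: intersections_def affine_hyp_def)
      then show ?thesis by (auto simp: affine_hyp_def)
    qed
    then show "(\<Sum>X\<in>?L. of_int (whitney (\<lambda>F. if F = {} then 0 else 1) UNIV {i\<in>?Z. X \<subseteq> lin i} hyp) *
        whitney flat_sign X {i\<in>?Z. \<not> X \<subseteq> lin i} lin) =
      (\<Sum>X\<in>?L. of_int (weight X) * whitney flat_sign X {i\<in>?Z. \<not> X \<subseteq> lin i} lin)"
      by (intro sum.cong) (simp_all add: weight_def)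
  qed (simp add: flat_sign_def)
  \<comment> \<open>The number of faces spanning \<open>X\<close>, a factor in
    \<open>whitney_flat_sign_intersection\<close>, becomes a sum over these faces.\<close>
  also have "(-1) ^ DIM('a) * \<dots> = (\<Sum>X\<in>?L. \<Sum>\<tau>\<in>{\<tau>\<in>?U. flat \<tau> = X}. ?g \<tau>)"
    unfolding sum_distrib_left
  proof (rule sum.cong)
    fix X assume X: "X \<in> ?L"
    have "{\<tau>\<in>?U. flat \<tau> = X} = {\<tau>\<in>range face. face_le (face v) \<tau> \<and> flat \<tau> = X}" by auto
    then have "(\<Sum>\<tau>\<in>{\<tau>\<in>?U. flat \<tau> = X}. ?g \<tau>) =
      (\<Sum>\<tau>\<in>{\<tau>\<in>range face. face_le (face v) \<tau> \<and> flat \<tau> = X}. (-1) ^ DIM('a) * flat_sign X * of_int (weight X))"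
      by (intro sum.cong) auto
    then show "(-1) ^ DIM('a) * (of_int (weight X) * whitney flat_sign X {i\<in>?Z. \<not> X \<subseteq> lin i} lin) =
        (\<Sum>\<tau>\<in>{\<tau>\<in>?U. flat \<tau> = X}. ?g \<tau>)"
      unfolding whitney_flat_sign_intersection(1)[OF X] by simp
  qed simp
  also have "\<dots> = (\<Sum>\<tau>\<in>?U. ?g \<tau>)"
  proof (rule sum.group[OF finU finite_intersections[OF finZ]], rule image_subsetI)
    fix \<tau> assume "\<tau> \<in> ?U"
    then obtain u where u: "\<tau> = face u" "face_le (face v) (face u)" by auto
    then have "zeros u \<subseteq> ?Z" by (auto simp: face_le_def signs_def sgn_0_0 split: if_splits)
    then show "flat \<tau> \<in> ?L" unfolding u(1) flat_face intersections_def by auto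
  qed
  finally have "(\<Sum>\<tau>\<in>?U. real (?N \<tau>)) = (\<Sum>\<tau>\<in>?U. ?g \<tau>)" .
  moreover have "(\<Sum>\<tau>\<in>?U - {face v}. real (?N \<tau>)) = (\<Sum>\<tau>\<in>?U - {face v}. ?g \<tau>)"
    using IH by (intro sum.cong) auto
  ultimately show ?case
    using sum.remove[OF finU vU, of "\<lambda>\<tau>. real (?N \<tau>)"] sum.remove[OF finU vU, of ?g] by simp
qed

text \<open>Chambers are grouped by top face, then by its flat \<open>X\<close>. The number of faces
  spanning \<open>X\<close> times \<open>flat_sign X\<close> is the value of the restricted
  polynomial at -1, so it cancels the denominator and leaves the Whitney expansion.\<close>

lemma whitney_eq_sum_chambers:
  "whitney flat_monom UNIV I hyp = (-1) ^ DIM('a) *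
    (\<Sum>\<epsilon>\<in>chambers w a I UNIV.
      let X = flat (top_face \<epsilon>); p = whitney flat_monom X {i\<in>I. \<not> X \<subseteq> lin i} lin
      in smult (1 / poly p (-1)) p)"
proof -
  let ?C = "chambers w a I UNIV" and ?T = "range face" and ?L = "intersections UNIV I lin"
  define W where "W X = whitney flat_monom X {i\<in>I. \<not> X \<subseteq> lin i} lin" for X
  define p where "p X = smult (1 / poly (W X) (-1)) (W X)" for X
  have finC: "finite ?C" using finite_I by (rule finite_chambers)
  have finT: "finite ?T" using finite_I by (rule finite_range_signs)
  \<comment> \<open>The vector 0 lies on every linear hyperplane and its face is below all others,
    so the local counts at 0 are counts over all faces.\<close>
  have zeros0: "zeros 0 = I" and face0: "face_le (face 0) \<tau>" for \<tau>
    by (auto simp: face_le_def signs_def)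
  have W: "poly (W X) (-1) = flat_sign X * real (card {\<tau>\<in>?T. flat \<tau> = X})" "poly (W X) (-1) \<noteq> 0"
    if X: "X \<in> ?L" for X
    using whitney_flat_sign_intersection[of X 0] X
    by (simp_all add: W_def poly_whitney poly_flat_monom face0)
  have "(\<Sum>\<epsilon>\<in>?C. p (flat (top_face \<epsilon>))) = (\<Sum>\<tau>\<in>?T. \<Sum>\<epsilon>\<in>{\<epsilon>\<in>?C. top_face \<epsilon> = \<tau>}. p (flat (top_face \<epsilon>)))"
    by (rule sum.group[symmetric]) (use finC finT top_face_in in auto)
  also have "\<dots> = (\<Sum>\<tau>\<in>?T. smult ((-1) ^ DIM('a) * flat_sign (flat \<tau>) * of_int (weight (flat \<tau>))) (p (flat \<tau>)))"
  proof (rule sum.cong)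
    fix \<tau> assume "\<tau> \<in> ?T"
    then obtain v where v: "\<tau> = face v" by auto
    have "(\<Sum>\<epsilon>\<in>{\<epsilon>\<in>?C. top_face \<epsilon> = \<tau>}. p (flat (top_face \<epsilon>))) =
        (\<Sum>\<epsilon>\<in>{\<epsilon>\<in>?C. top_face \<epsilon> = \<tau>}. p (flat \<tau>))" by (intro sum.cong) auto
    also have "\<dots> = smult (real (card {\<epsilon>\<in>?C. top_face \<epsilon> = \<tau>})) (p (flat \<tau>))"
      by (simp add: of_nat_poly)
    finally show "(\<Sum>\<epsilon>\<in>{\<epsilon>\<in>?C. top_face \<epsilon> = \<tau>}. p (flat (top_face \<epsilon>))) =
        smult ((-1) ^ DIM('a) * flat_sign (flat \<tau>) * of_int (weight (flat \<tau>))) (p (flat \<tau>))"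
      unfolding v card_top_face .
  qed simp
  also have "\<dots> = (\<Sum>X\<in>?L. \<Sum>\<tau>\<in>{\<tau>\<in>?T. flat \<tau> = X}.
      smult ((-1) ^ DIM('a) * flat_sign (flat \<tau>) * of_int (weight (flat \<tau>))) (p (flat \<tau>)))"
    by (rule sum.group[symmetric, OF finT finite_intersections[OF finite_I]])
      (auto simp: intersections_def flat_def)
  also have "\<dots> = (\<Sum>X\<in>?L. smult ((-1) ^ DIM('a) * of_int (weight X)) (W X))"
  proof (rule sum.cong)
    fix X assume X: "X \<in> ?L"
    have "(\<Sum>\<tau>\<in>{\<tau>\<in>?T. flat \<tau> = X}.
        smult ((-1) ^ DIM('a) * flat_sign (flat \<tau>) * of_int (weight (flat \<tau>))) (p (flat \<tau>))) =
      (\<Sum>\<tau>\<in>{\<tau>\<in>?T. flat \<tau> = X}. smult ((-1) ^ DIM('a) * flat_sign X * of_int (weight X)) (p X))"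
      by (intro sum.cong) auto
    also have "\<dots> = smult ((-1) ^ DIM('a) * of_int (weight X) * poly (W X) (-1)) (p X)"
      by (simp add: of_nat_poly W(1)[OF X] mult_ac)
    also have "\<dots> = smult ((-1) ^ DIM('a) * of_int (weight X)) (W X)"
      using W(2)[OF X] by (simp add: p_def)
    finally show "(\<Sum>\<tau>\<in>{\<tau>\<in>?T. flat \<tau> = X}.
        smult ((-1) ^ DIM('a) * flat_sign (flat \<tau>) * of_int (weight (flat \<tau>))) (p (flat \<tau>))) =
      smult ((-1) ^ DIM('a) * of_int (weight X)) (W X)" .
  qed simp
  also have "\<dots> = smult ((-1) ^ DIM('a)) (\<Sum>X\<in>?L. smult (of_int (weight X)) (W X))"
  proof -
    have "smult c (\<Sum>X\<in>L. f X) = (\<Sum>X\<in>L. smult c (f X))" for c :: real and f and L :: "'a set set"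
      by (induction L rule: infinite_finite_induct) (simp_all add: smult_add_right)
    then show ?thesis by simp
  qed
  also have "(\<Sum>X\<in>?L. smult (of_int (weight X)) (W X)) = whitney flat_monom UNIV I hyp"
  proof (subst whitney_expansion[OF finite_I, where l = lin])
    fix S assume "\<Inter>(hyp ` S) \<noteq> {}"
    moreover have "\<Inter>(lin ` S) \<noteq> {}" using subspace_0[OF subspace_Inter_affine_hyp[of w S]] by blast
    ultimately show "flat_monom (\<Inter>(hyp ` S)) = flat_monom (\<Inter>(lin ` S))"
      by (simp add: flat_monom_def aff_dim_Inter_affine_hyp[of w a S])
  qed (simp_all add: flat_monom_def weight_def[symmetric] W_def of_int_poly)
  finally have "(\<Sum>\<epsilon>\<in>?C. p (flat (top_face \<epsilon>))) = smult ((-1) ^ DIM('a)) (whitney flat_monom UNIV I hyp)" .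
  then have "smult ((-1) ^ DIM('a)) (\<Sum>\<epsilon>\<in>?C. p (flat (top_face \<epsilon>))) = whitney flat_monom UNIV I hyp"
    by (simp flip: power_mult_distrib)
  moreover have "(-1) ^ DIM('a) * q = smult ((-1) ^ DIM('a)) q" for q :: "real poly"
    by (cases "even DIM('a)") simp_all
  ultimately show ?thesis by (simp add: p_def W_def Let_def)
qed

end


subsection \<open>Regions and restrictions of a hyperplane arrangement\<close>

definition chamber_set :: "('i \<Rightarrow> 'a::euclidean_space) \<Rightarrow> ('i \<Rightarrow> real) \<Rightarrow> 'i set \<Rightarrow> ('i \<Rightarrow> real) \<Rightarrow> 'a set" where
  "chamber_set w a I \<epsilon> = {x. signs w a I x = \<epsilon>}"

text \<open>By the intermediate value theorem a connected set that avoids the hyperplanes stays on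
  one side of each; conversely a chamber is convex, hence connected.\<close>

lemma components_eq_chambers:
  fixes w :: "'i \<Rightarrow> 'a::euclidean_space"
  shows "components (UNIV - \<Union>(affine_hyp w a ` I)) = chamber_set w a I ` chambers w a I UNIV"
proof -
  let ?U = "UNIV - \<Union>(affine_hyp w a ` I)"
  have U: "?U = generic w a I UNIV" by (auto simp: generic_def affine_hyp_def)
  have comp: "connected_component_set ?U x = chamber_set w a I (signs w a I x)"
    if x: "x \<in> generic w a I UNIV" for x
  proof (intro subset_antisym subsetI)
    let ?C = "connected_component_set ?U x"
    fix y assume y: "y \<in> ?C"
    have xC: "x \<in> ?C" using x U by simp
    have C: "connected ?C" "?C \<subseteq> generic w a I UNIV"
      using connected_component_subset[of ?U x] U by auto
    have avoid: "\<not> (w i \<bullet> u \<le> a i \<and> a i \<le> w i \<bullet> v)" if i: "i \<in> I" and uv: "u \<in> ?C" "v \<in> ?C" for i u v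
    proof
      assume "w i \<bullet> u \<le> a i \<and> a i \<le> w i \<bullet> v"
      then obtain z where "z \<in> ?C" "w i \<bullet> z = a i"
        using connected_ivt_hyperplane[OF C(1) uv] by blast
      then show False using C(2) i by (auto simp: generic_def)
    qed
    have "signs w a I y = signs w a I x"
    proof
      fix i show "signs w a I y i = signs w a I x i"
      proof (cases "i \<in> I")
        case True
        then show ?thesis using avoid[OF True xC y] avoid[OF True y xC]
          by (auto simp: signs_def sgn_real_def)
      qed (simp add: signs_def)
    qed
    then show "y \<in> chamber_set w a I (signs w a I x)" by (simp add: chamber_set_def)
  next
    fix y assume "y \<in> chamber_set w a I (signs w a I x)"
    then have "signs w a I y = signs w a I x" by (simp add: chamber_set_def)
    note segment = signs_segment(2)[OF x this]
    have "closed_segment x y \<subseteq> ?U" unfolding U closed_segment_def using segment by auto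
    then have "closed_segment x y \<subseteq> connected_component_set ?U x"
      by (intro connected_component_maximal) auto
    then show "y \<in> connected_component_set ?U x" by auto
  qed
  show ?thesis
    unfolding components_def chambers_def image_image using comp U by (auto intro!: image_cong)
qed

lemma inj_on_chamber_set: "inj_on (chamber_set w a I) (chambers w a I UNIV)"
  by (rule inj_onI) (auto simp: chambers_def chamber_set_def)

text \<open>A chamber is cut out by strict inequalities, which a step \<open>v\<close> with
  nonnegative products preserves. If one product were negative, repeating the step would eventually
  violate its inequality.\<close>

lemma Rec_chamber_set:
  assumes "\<epsilon> \<in> chambers w a I UNIV"
  shows "Rec (chamber_set w a I \<epsilon>) = {v. \<forall>i\<in>I. 0 \<le> \<epsilon> i * (w i \<bullet> v)}"
proof (intro subset_antisym subsetI)
  obtain x where x: "x \<in> generic w a I UNIV" "\<epsilon> = signs w a I x"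
    using assms by (auto simp: chambers_def)
  let ?R = "chamber_set w a I \<epsilon>"
  have pm: "\<epsilon> i = 1 \<or> \<epsilon> i = -1" if "i \<in> I" for i
    using x that by (auto simp: generic_def signs_def sgn_real_def split: if_splits)
  have R: "y \<in> ?R \<longleftrightarrow> (\<forall>i\<in>I. 0 < \<epsilon> i * (w i \<bullet> y - a i))" for y
  proof -
    have "sgn r = \<epsilon> i \<longleftrightarrow> 0 < \<epsilon> i * r" if "i \<in> I" for i and r :: real
      using pm[OF that] by (elim disjE) (simp_all add: sgn_real_def)
    moreover have "\<epsilon> i = 0" if "i \<notin> I" for i using that x(2) by (simp add: signs_def)
    ultimately show ?thesis by (auto simp: chamber_set_def signs_def fun_eq_iff)
  qed
  fix v
  {
    assume v: "v \<in> Rec ?R"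
    have step: "y + v \<in> ?R" if "y \<in> ?R" for y using v that by (auto simp: Rec_def)
    have iter: "x + real k *\<^sub>R v \<in> ?R" for k
    proof (induction k)
      case 0
      then show ?case using x(2) by (simp add: chamber_set_def)
    next
      case (Suc k)
      then show ?case using step[OF Suc] by (simp add: algebra_simps)
    qed
    show "v \<in> {v. \<forall>i\<in>I. 0 \<le> \<epsilon> i * (w i \<bullet> v)}"
    proof (intro CollectI ballI, rule ccontr)
      fix i assume i: "i \<in> I" and "\<not> 0 \<le> \<epsilon> i * (w i \<bullet> v)"
      then have neg: "- (\<epsilon> i * (w i \<bullet> v)) > 0" by simp
      obtain k where "\<epsilon> i * (w i \<bullet> x - a i) < real k * - (\<epsilon> i * (w i \<bullet> v))"
        using reals_Archimedean3[OF neg] by blast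
      moreover have "0 < \<epsilon> i * (w i \<bullet> (x + real k *\<^sub>R v) - a i)" using iter[of k] R i by blast
      ultimately show False by (simp add: inner_add_right algebra_simps)
    qed
  next
    assume v: "v \<in> {v. \<forall>i\<in>I. 0 \<le> \<epsilon> i * (w i \<bullet> v)}"
    have "y + v \<in> ?R" if y: "y \<in> ?R" for y
      unfolding R
    proof
      fix i assume i: "i \<in> I"
      have "0 < \<epsilon> i * (w i \<bullet> y - a i) + \<epsilon> i * (w i \<bullet> v)"
        using y i v unfolding R by (intro add_pos_nonneg) auto
      then show "0 < \<epsilon> i * (w i \<bullet> (y + v) - a i)" by (simp add: inner_add_right algebra_simps)
    qed
    then show "v \<in> Rec ?R" by (auto simp: Rec_def)
  }
qed

section \<open>Centralization and restriction\<close>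

text \<open>The right-hand side uses the hyperplane only as a set, so the linear hyperplane does not
  depend on the chosen normal and offset.\<close>

lemma hyperplane_directions:
  fixes w :: "'a::euclidean_space"
  assumes "w \<noteq> 0"
  shows "{x. w \<bullet> x = 0} = {v. \<forall>y\<in>{x. w \<bullet> x = a}. y + v \<in> {x. w \<bullet> x = a}}"
proof -
  \<comment> \<open>A point on the hyperplane, so that the universal quantifier is not
    vacuous.\<close>
  have "w \<bullet> ((a / (w \<bullet> w)) *\<^sub>R w) = a" using assms by simp
  then have "\<exists>y. w \<bullet> y = a" by blast
  then show ?thesis by (auto simp: inner_add_right)
qed

text \<open>The definition admits every normal of a hyperplane; by
  \<open>hyperplane_directions\<close> one chosen normal per hyperplane yields the same
  sets.\<close>

lemma centralization_eq:
  assumes "\<And>H. H \<in> A \<Longrightarrow> w H \<noteq> 0 \<and> H = affine_hyp w a H"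
  shows "centralization A = affine_hyp w (\<lambda>_. 0) ` A"
proof (intro subset_antisym subsetI)
  fix K assume "K \<in> centralization A"
  then obtain u b where u: "u \<noteq> 0" "{x. u \<bullet> x = b} \<in> A" "K = {x. u \<bullet> x = 0}"
    by (auto simp: centralization_def)
  let ?H = "{x. u \<bullet> x = b}"
  have H: "w ?H \<noteq> 0" "?H = {x. w ?H \<bullet> x = a ?H}"
    using assms[OF u(2)] by (auto simp: affine_hyp_def)
  have "K = {v. \<forall>y\<in>?H. y + v \<in> ?H}" unfolding u(3) by (rule hyperplane_directions[OF u(1)])
  also have "\<dots> = {x. w ?H \<bullet> x = 0}"
    using hyperplane_directions[OF H(1), of "a ?H"] H(2) by simp
  finally have "K = affine_hyp w (\<lambda>_. 0) ?H" by (simp add: affine_hyp_def)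
  then show "K \<in> affine_hyp w (\<lambda>_. 0) ` A" using u(2) by (rule image_eqI)
next
  fix K assume "K \<in> affine_hyp w (\<lambda>_. 0) ` A"
  then obtain H where H: "H \<in> A" "K = {x. w H \<bullet> x = 0}" by (auto simp: affine_hyp_def)
  then have "w H \<noteq> 0" "{x. w H \<bullet> x = a H} \<in> A" using assms[OF H(1)] by (auto simp: affine_hyp_def)
  then show "K \<in> centralization A" unfolding centralization_def H(2) by blast
qed

text \<open>Dropping \<open>V\<close> from the restriction amounts to dropping the indices with
  \<open>V \<subseteq> l i\<close>, and intersecting each \<open>l i\<close> with \<open>V\<close>
  beforehand does not change the flats inside \<open>V\<close>.\<close>

lemma flats_restriction:
  assumes V: "0 \<in> V" and l: "\<And>i. i \<in> I \<Longrightarrow> 0 \<in> l i"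
  shows "flats V (restriction (l ` I) V) = intersections V {i\<in>I. \<not> V \<subseteq> l i} l - {{}}"
proof -
  let ?J = "{i\<in>I. \<not> V \<subseteq> l i}"
  have "restriction (l ` I) V = (\<lambda>i. l i \<inter> V) ` ?J"
    using V l by (auto simp: restriction_def)
  then have "flats V (restriction (l ` I) V) =
      {F. F \<noteq> {} \<and> (\<exists>S\<subseteq>?J. F = V \<inter> \<Inter>((\<lambda>i. l i \<inter> V) ` S))}"
    by (auto simp: flats_def subset_image_iff)
  moreover have "V \<inter> \<Inter>((\<lambda>i. l i \<inter> V) ` S) = V \<inter> \<Inter>(l ` S)" for S by auto
  ultimately show ?thesis by (auto simp: intersections_def)
qed

theorem theorem6p4:
  fixes A :: "(real ^ 'n::finite) set set"
  assumes "hyperplane_arrangement A"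
  shows "charpoly UNIV A =
    (-1) ^ CARD('n) *
    (\<Sum>R\<in>regions A.
       let V = rec_space R; p = charpoly V (restriction (centralization A) V)
       in smult (1 / poly p (-1)) p)"
proof -
  have finA: "finite A" and "\<forall>H\<in>A. \<exists>w a. w \<noteq> 0 \<and> H = {x. w \<bullet> x = a}"
    using assms by (auto simp: hyperplane_arrangement_def)
  then obtain w a where wa: "\<And>H. H \<in> A \<Longrightarrow> w H \<noteq> 0 \<and> H = {x. w H \<bullet> x = a H}"
    by metis
  \<comment> \<open>Each hyperplane of \<open>A\<close> is its own index, with the normal and offset
    just chosen.\<close>
  interpret affine_family w a A by standard (rule finA)
  have hyp: "hyp H = H" if "H \<in> A" for H using wa[OF that] by (simp add: affine_hyp_def)
  have cent: "centralization A = lin ` A"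
    by (rule centralization_eq[where a = a]) (use wa in \<open>auto simp: affine_hyp_def\<close>)
  have "charpoly UNIV A = whitney flat_monom UNIV A hyp"
  proof (rule charpoly_eq_whitney[OF finA])
    fix H assume "H \<in> A"
    then have "w H \<noteq> 0" using wa by blast
    \<comment> \<open>A multiple of the normal at which the linear form takes the value
      \<open>a H + 1\<close>, hence off the hyperplane.\<close>
    then have "((a H + 1) / (w H \<bullet> w H)) *\<^sub>R w H \<notin> hyp H" by (simp add: affine_hyp_def)
    then show "\<not> UNIV \<subseteq> hyp H" by blast
  next
    have "\<Inter>(hyp ` S) = \<Inter>S" if "S \<subseteq> A" for S
      using hyp that by (metis image_cong image_ident subsetD)
    then show "flats UNIV A = intersections UNIV A hyp - {{}}"
      by (auto simp: flats_def intersections_def)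
  qed
  also have "\<dots> = (-1) ^ CARD('n) * (\<Sum>\<epsilon>\<in>chambers w a A UNIV.
      let X = flat (top_face \<epsilon>); p = whitney flat_monom X {i\<in>A. \<not> X \<subseteq> lin i} lin
      in smult (1 / poly p (-1)) p)"
    using whitney_eq_sum_chambers by simp
  also have "(\<Sum>\<epsilon>\<in>chambers w a A UNIV.
      let X = flat (top_face \<epsilon>); p = whitney flat_monom X {i\<in>A. \<not> X \<subseteq> lin i} lin
      in smult (1 / poly p (-1)) p) =
    (\<Sum>R\<in>regions A. let V = rec_space R; p = charpoly V (restriction (centralization A) V)
       in smult (1 / poly p (-1)) p)"
  \<comment> \<open>Regions correspond to sign vectors of chambers; under this bijection the
    recession space becomes the flat of the top face.\<close>
  proof (rule sum.reindex_cong[OF inj_on_chamber_set[of w a A], symmetric])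
    have "hyp ` A = A" using hyp by (metis image_cong image_ident)
    then show "regions A = chamber_set w a A ` chambers w a A UNIV"
      using components_eq_chambers[of w a A] by (simp add: regions_def)
  next
    fix \<epsilon> assume \<epsilon>: "\<epsilon> \<in> chambers w a A UNIV"
    let ?X = "flat (top_face \<epsilon>)"
    have V: "rec_space (chamber_set w a A \<epsilon>) = ?X"
      unfolding rec_space_def Rec_chamber_set[OF \<epsilon>] by (rule span_cone[OF \<epsilon>])
    have "0 \<in> ?X" unfolding V[symmetric] rec_space_def by (rule span_zero)
    then have "charpoly ?X (restriction (centralization A) ?X) =
        whitney flat_monom ?X {i\<in>A. \<not> ?X \<subseteq> lin i} lin"
      unfolding cent
      by (intro charpoly_eq_whitney flats_restriction) (use finA in \<open>auto simp: affine_hyp_def\<close>)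
    then show "(let V = rec_space (chamber_set w a A \<epsilon>); p = charpoly V (restriction (centralization A) V)
        in smult (1 / poly p (-1)) p) =
      (let X = flat (top_face \<epsilon>); p = whitney flat_monom X {i\<in>A. \<not> X \<subseteq> lin i} lin
        in smult (1 / poly p (-1)) p)"
      unfolding V by simp
  qed
  finally show ?thesis .
qed

end
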